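(* The group of topos automorphisms of $\mathrm{M}_2^{\mathrm{ns}}(\mathbb{Z})\text{-}\mathsf{Set}$ up to natural isomorphism can be identified with (is isomorphic to) the group of characters $\chi:\mathbb{Q}^\times\to\{1,-1\}$ under pointwise multiplication.
   Context: $\mathrm{M}_2^{\mathrm{ns}}(\mathbb{Z})$ is the monoid (under multiplication) of $2\times 2$ integer matrices with nonzero determinant; $\mathrm{M}_2^{\mathrm{ns}}(\mathbb{Z})\text{-}\mathsf{Set}$ is the topos of sets with a left action of it and equivariant maps. A topos automorphism is an equivalence of this category with itself; the group operation is composition. A character $\mathbb{Q}^\times\to\{1,-1\}$ is a group homomorphism. *)

theory Defs
  imports "HOL-Analysis.Determinants" "HOL-Algebra.Group"
begin

section \<open>Categories, functors and natural isomorphisms\<close>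

record ('o, 'a) category =
  Obj :: "'o set"
  Arr :: "'a set"
  Dom :: "'a \<Rightarrow> 'o"
  Cod :: "'a \<Rightarrow> 'o"
  Id :: "'o \<Rightarrow> 'a"
  Comp :: "'a \<Rightarrow> 'a \<Rightarrow> 'a"  \<comment> \<open>\<open>Comp C g f\<close> is "g after f"\<close>

locale is_category =
  fixes C :: "('o, 'a) category"
  assumes dom_obj: "f \<in> Arr C \<Longrightarrow> Dom C f \<in> Obj C"
    and cod_obj: "f \<in> Arr C \<Longrightarrow> Cod C f \<in> Obj C"
    and id_arr: "X \<in> Obj C \<Longrightarrow> Id C X \<in> Arr C \<and> Dom C (Id C X) = X \<and> Cod C (Id C X) = X"
    and comp_arr: "\<lbrakk>f \<in> Arr C; g \<in> Arr C; Cod C f = Dom C g\<rbrakk> \<Longrightarrow>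
      Comp C g f \<in> Arr C \<and> Dom C (Comp C g f) = Dom C f \<and> Cod C (Comp C g f) = Cod C g"
    and id_left: "f \<in> Arr C \<Longrightarrow> Comp C (Id C (Cod C f)) f = f"
    and id_right: "f \<in> Arr C \<Longrightarrow> Comp C f (Id C (Dom C f)) = f"
    and comp_assoc: "\<lbrakk>f \<in> Arr C; g \<in> Arr C; h \<in> Arr C; Cod C f = Dom C g; Cod C g = Dom C h\<rbrakk> \<Longrightarrow>
      Comp C h (Comp C g f) = Comp C (Comp C h g) f"

definition is_iso_arr :: "('o, 'a) category \<Rightarrow> 'a \<Rightarrow> bool" where
  "is_iso_arr C f \<longleftrightarrow> f \<in> Arr C \<and>
     (\<exists>g \<in> Arr C. Dom C g = Cod C f \<and> Cod C g = Dom C f \<and>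
        Comp C g f = Id C (Dom C f) \<and> Comp C f g = Id C (Cod C f))"

record ('o, 'a, 'p, 'b) functor_data =
  obj_map :: "'o \<Rightarrow> 'p"
  arr_map :: "'a \<Rightarrow> 'b"

definition is_functor ::
    "('o, 'a) category \<Rightarrow> ('p, 'b) category \<Rightarrow> ('o, 'a, 'p, 'b) functor_data \<Rightarrow> bool" where
  "is_functor C D F \<longleftrightarrow>
     (\<forall>X \<in> Obj C. obj_map F X \<in> Obj D \<and> arr_map F (Id C X) = Id D (obj_map F X)) \<and>
     (\<forall>f \<in> Arr C. arr_map F f \<in> Arr D \<and>
        Dom D (arr_map F f) = obj_map F (Dom C f) \<and> Cod D (arr_map F f) = obj_map F (Cod C f)) \<and>
     (\<forall>f \<in> Arr C. \<forall>g \<in> Arr C. Cod C f = Dom C g \<longrightarrow>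
        arr_map F (Comp C g f) = Comp D (arr_map F g) (arr_map F f))"

definition id_functor :: "('o, 'a, 'o, 'a) functor_data" where
  "id_functor = \<lparr>obj_map = (\<lambda>X. X), arr_map = (\<lambda>f. f)\<rparr>"

definition comp_functor ::
    "('p, 'b, 'q, 'c) functor_data \<Rightarrow> ('o, 'a, 'p, 'b) functor_data \<Rightarrow> ('o, 'a, 'q, 'c) functor_data" where
  "comp_functor G F = \<lparr>obj_map = obj_map G \<circ> obj_map F, arr_map = arr_map G \<circ> arr_map F\<rparr>"

definition naturally_isomorphic ::
    "('o, 'a) category \<Rightarrow> ('p, 'b) category \<Rightarrow>
     ('o, 'a, 'p, 'b) functor_data \<Rightarrow> ('o, 'a, 'p, 'b) functor_data \<Rightarrow> bool" where
  "naturally_isomorphic C D F G \<longleftrightarrow>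
     (\<exists>\<eta>. (\<forall>X \<in> Obj C. is_iso_arr D (\<eta> X) \<and>
              Dom D (\<eta> X) = obj_map F X \<and> Cod D (\<eta> X) = obj_map G X) \<and>
          (\<forall>f \<in> Arr C. Comp D (\<eta> (Cod C f)) (arr_map F f) = Comp D (arr_map G f) (\<eta> (Dom C f))))"

definition is_equivalence ::
    "('o, 'a) category \<Rightarrow> ('p, 'b) category \<Rightarrow> ('o, 'a, 'p, 'b) functor_data \<Rightarrow> bool" where
  "is_equivalence C D F \<longleftrightarrow> is_functor C D F \<and>
     (\<exists>G. is_functor D C G \<and>
        naturally_isomorphic C C (comp_functor G F) id_functor \<and>
        naturally_isomorphic D D (comp_functor F G) id_functor)"

definition auto_equivalences :: "('o, 'a) category \<Rightarrow> ('o, 'a, 'o, 'a) functor_data set" where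
  "auto_equivalences C = {F. is_equivalence C C F}"

definition nat_iso_rel ::
    "('o, 'a) category \<Rightarrow> (('o, 'a, 'o, 'a) functor_data \<times> ('o, 'a, 'o, 'a) functor_data) set" where
  "nat_iso_rel C = {(F, G). F \<in> auto_equivalences C \<and> G \<in> auto_equivalences C \<and>
                            naturally_isomorphic C C F G}"

text \<open>
  Functors are only constrained on the objects and arrows of their source category. Two functors
  that agree there are naturally isomorphic, so their values elsewhere do not affect the quotient.
\<close>

definition auto_equivalence_group ::
    "('o, 'a) category \<Rightarrow> ('o, 'a, 'o, 'a) functor_data set monoid" where
  "auto_equivalence_group C =
     \<lparr>carrier = auto_equivalences C // nat_iso_rel C,
      mult = (\<lambda>A B. \<Union>F \<in> A. \<Union>G \<in> B. nat_iso_rel C `` {comp_functor F G}),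
      one = nat_iso_rel C `` {id_functor}\<rparr>"


section \<open>Small sets\<close>

text \<open>
  A collection of "small" subsets of a type, replacing the class of all sets. If the type has the
  elements of a Grothendieck universe containing an infinite set, then its members, viewed as sets
  of elements, form such a collection. Closure under power sets is deliberately not demanded:
  HOL does not prove that any infinite collection with that closure property exists, whereas the
  conditions below are met by all subsets of any infinite type.
\<close>

definition set_universe :: "'u set set \<Rightarrow> bool" where
  "set_universe U \<longleftrightarrow>
     (\<exists>S \<in> U. infinite S) \<and>
     (\<forall>S \<in> U. \<forall>T. T \<subseteq> S \<longrightarrow> T \<in> U) \<and>
     (\<forall>S \<in> U. \<forall>f. f ` S \<in> U) \<and>
     (\<forall>I \<in> U. \<forall>S. (\<forall>i \<in> I. S i \<in> U) \<longrightarrow> (\<Union>i \<in> I. S i) \<in> U)"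

lemma set_universe_UNIV: "infinite (UNIV :: 'u set) \<Longrightarrow> set_universe (UNIV :: 'u set set)"
  by (auto simp: set_universe_def)


section \<open>Sets with a left action of a monoid\<close>

record ('m, 'u) action_set = "'u partial_object" +
  act :: "'m \<Rightarrow> 'u \<Rightarrow> 'u"

text \<open>
  The extensional function spaces make the action undefined outside \<open>carrier M\<close> and \<open>carrier X\<close>,
  so that equality in HOL is equality of sets with an action.
\<close>

definition is_action_set :: "('m, 'b) monoid_scheme \<Rightarrow> ('m, 'u) action_set \<Rightarrow> bool" where
  "is_action_set M X \<longleftrightarrow>
     act X \<in> carrier M \<rightarrow>\<^sub>E (carrier X \<rightarrow>\<^sub>E carrier X) \<and>
     (\<forall>x \<in> carrier X. act X \<one>\<^bsub>M\<^esub> x = x) \<and>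
     (\<forall>m \<in> carrier M. \<forall>n \<in> carrier M. \<forall>x \<in> carrier X.
        act X (m \<otimes>\<^bsub>M\<^esub> n) x = act X m (act X n x))"

definition equivariant_maps ::
    "('m, 'b) monoid_scheme \<Rightarrow> ('m, 'u) action_set \<Rightarrow> ('m, 'u) action_set \<Rightarrow> ('u \<Rightarrow> 'u) set" where
  "equivariant_maps M X Y =
     {f \<in> carrier X \<rightarrow>\<^sub>E carrier Y.
        \<forall>m \<in> carrier M. \<forall>x \<in> carrier X. f (act X m x) = act Y m (f x)}"

type_synonym ('m, 'u) action_arrow = "('m, 'u) action_set \<times> ('u \<Rightarrow> 'u) \<times> ('m, 'u) action_set"

definition action_category ::
    "('m, 'b) monoid_scheme \<Rightarrow> 'u set set \<Rightarrow> (('m, 'u) action_set, ('m, 'u) action_arrow) category" where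
  "action_category M U =
     \<lparr>Obj = {X. is_action_set M X \<and> carrier X \<in> U},
      Arr = {(X, f, Y). is_action_set M X \<and> carrier X \<in> U \<and>
                        is_action_set M Y \<and> carrier Y \<in> U \<and> f \<in> equivariant_maps M X Y},
      Dom = (\<lambda>(X, f, Y). X),
      Cod = (\<lambda>(X, f, Y). Y),
      Id = (\<lambda>X. (X, restrict (\<lambda>x. x) (carrier X), X)),
      Comp = (\<lambda>(Y, g, Z) (X, f, W). (X, compose (carrier X) g f, Z))\<rparr>"

lemma act_closed:
  "is_action_set M X \<Longrightarrow> m \<in> carrier M \<Longrightarrow> x \<in> carrier X \<Longrightarrow> act X m x \<in> carrier X"
  by (auto simp: is_action_set_def)

lemma equivariant_id: "is_action_set M X \<Longrightarrow> restrict (\<lambda>x. x) (carrier X) \<in> equivariant_maps M X X"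
  by (auto simp: equivariant_maps_def act_closed)

lemma equivariant_compose:
  assumes "is_action_set M X" "f \<in> equivariant_maps M X Y" "g \<in> equivariant_maps M Y Z"
  shows "compose (carrier X) g f \<in> equivariant_maps M X Z"
  using assms by (fastforce simp: equivariant_maps_def compose_def act_closed)

lemma action_category_is_category: "is_category (action_category M U)"
proof
  fix f assume f: "f \<in> Arr (action_category M U)"
  show "Comp (action_category M U) (Id (action_category M U) (Cod (action_category M U) f)) f = f"
    using f by (auto simp: action_category_def equivariant_maps_def compose_def restrict_def
        fun_eq_iff PiE_iff extensional_def)
  show "Comp (action_category M U) f (Id (action_category M U) (Dom (action_category M U) f)) = f"
    using f by (auto simp: action_category_def equivariant_maps_def compose_def restrict_def
        fun_eq_iff PiE_iff extensional_def)
next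
  fix f g h
  assume "f \<in> Arr (action_category M U)" "g \<in> Arr (action_category M U)"
    "h \<in> Arr (action_category M U)" "Cod (action_category M U) f = Dom (action_category M U) g"
    "Cod (action_category M U) g = Dom (action_category M U) h"
  then show "Comp (action_category M U) h (Comp (action_category M U) g f)
    = Comp (action_category M U) (Comp (action_category M U) h g) f"
    by (auto simp: action_category_def equivariant_maps_def compose_def restrict_def
        fun_eq_iff PiE_iff)
qed (auto simp: action_category_def intro: equivariant_id equivariant_compose)


section \<open>Nonsingular integer matrices and quadratic characters\<close>

definition M2ns :: "(int^2^2) monoid" where
  "M2ns = \<lparr>carrier = {A. det A \<noteq> 0}, mult = (**), one = mat 1\<rparr>"

lemma monoid_M2ns: "monoid M2ns"
  by unfold_locales (auto simp: M2ns_def det_mul matrix_mul_assoc)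

definition rat_units :: "rat monoid" where
  "rat_units = \<lparr>carrier = {q. q \<noteq> 0}, mult = (*), one = 1\<rparr>"

definition sign_group :: "int monoid" where
  "sign_group = \<lparr>carrier = {1, -1}, mult = (*), one = 1\<rparr>"

text \<open>Characters are made extensional, since \<^const>\<open>hom\<close> leaves the value at 0 arbitrary.\<close>

definition sign_character_group :: "(rat \<Rightarrow> int) monoid" where
  "sign_character_group =
     \<lparr>carrier = hom rat_units sign_group \<inter> extensional (carrier rat_units),
      mult = (\<lambda>\<phi> \<psi>. \<lambda>q \<in> carrier rat_units. \<phi> q \<otimes>\<^bsub>sign_group\<^esub> \<psi> q),
      one = (\<lambda>q \<in> carrier rat_units. \<one>\<^bsub>sign_group\<^esub>)\<rparr>"

end

theory Submission
  imports Defs "HOL-Computational_Algebra.Primes"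
begin

text \<open>
  Write \<open>M\<close> for the monoid of nonsingular integer matrices. The proof has a part that works for
  every monoid whose only idempotent is the unit, and a part about \<open>2\<times>2\<close> matrices.

  Let \<open>R\<close> be \<open>M\<close> acting on itself by left multiplication. Elements of an
  \<open>M\<close>-set \<open>X\<close> are the same as maps \<open>R \<rightarrow> X\<close>, so an
  auto-equivalence \<open>F\<close> is known once \<open>F R\<close> is known together with the action of
  \<open>F\<close> on \<open>End R\<close>, which is \<open>M\<close> with its multiplication reversed. When
  \<open>M\<close> has no idempotent except \<open>1\<close>, \<open>F R\<close> is again free on one
  generator \<open>u\<close> (\<open>image_of_regular_free\<close>): the nonunits of \<open>R\<close> are a
  largest proper subobject, and therefore some map to \<open>R\<close> from an object \<open>P\<close> with
  \<open>F P \<cong> R\<close> is surjective (\<open>map_hitting_unit\<close>); such a map splits, hence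
  \<open>F R\<close> is a retract of \<open>R\<close>, and retracts of \<open>R\<close> correspond to
  idempotents of \<open>M\<close>. Sending \<open>x\<close> to the image of \<open>u\<close> under
  \<open>F\<close> of the map \<open>R \<rightarrow> X\<close>, \<open>m \<mapsto> m x\<close>, gives a
  natural bijection from \<open>X\<close> to \<open>F X\<close> that intertwines the actions up to an
  automorphism \<open>\<alpha>\<close> of \<open>M\<close> (\<open>auto_equivalence_is_twist\<close>). So
  every auto-equivalence is, up to isomorphism, the twist by an automorphism, and conjugate automorphisms
  give isomorphic twists.

  Every automorphism of \<open>M\<close> has the form \<open>A \<mapsto> \<epsilon> (det A)
  P\<^sup>-\<^sup>1 A P\<close> with \<open>P\<close> unimodular and \<open>\<epsilon>\<close> a
  multiplicative sign on the nonzero integers (\<open>M2ns_automorphism_sign_conjugation\<close>). The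
  elementary matrix with entry \<open>1\<close> above the diagonal is intertwined with its
  \<open>n\<close>-th power by \<open>diag(n, 1)\<close>, which forces its image to be unipotent; after a
  conjugation the image is the same matrix again. The diagonal matrices are determined up to sign by how
  they rescale elementary matrices and by commuting with each other, and the Euclidean algorithm extends the
  formula to all of \<open>M\<close>. Since \<open>\<epsilon>\<close> extends to a character of the nonzero
  rationals (\<open>extend_sign_character\<close>), every auto-equivalence is isomorphic to the twist by
  \<open>A \<mapsto> \<chi> (det A) A\<close> for a sign character \<open>\<chi>\<close>. Different
  characters give nonisomorphic twists, because some matrix of determinant \<open>n\<close> has nonzero
  trace, which detects \<open>\<chi> n\<close> (\<open>sign_twist_intertwined\<close>). Twists compose by
  multiplying the characters, which gives the isomorphism of groups.
\<close>

section \<open>Natural isomorphisms and auto-equivalences\<close>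

text \<open>
  The components are a parameter here, so that proofs can name and compose them.
\<close>

definition natural_iso_between ::
    "('o, 'a) category \<Rightarrow> ('o \<Rightarrow> 'a) \<Rightarrow> ('o, 'a, 'o, 'a) functor_data \<Rightarrow> ('o, 'a, 'o, 'a) functor_data \<Rightarrow> bool" where
  "natural_iso_between C \<eta> F G \<longleftrightarrow>
     (\<forall>X \<in> Obj C. is_iso_arr C (\<eta> X) \<and> Dom C (\<eta> X) = obj_map F X \<and> Cod C (\<eta> X) = obj_map G X) \<and>
     (\<forall>f \<in> Arr C. Comp C (\<eta> (Cod C f)) (arr_map F f) = Comp C (arr_map G f) (\<eta> (Dom C f)))"

lemma naturally_isomorphic_iff: "naturally_isomorphic C C F G \<longleftrightarrow> (\<exists>\<eta>. natural_iso_between C \<eta> F G)"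
  by (simp add: naturally_isomorphic_def natural_iso_between_def)

lemma comp_functor_simps [simp]:
  "obj_map (comp_functor G F) X = obj_map G (obj_map F X)"
  "arr_map (comp_functor G F) f = arr_map G (arr_map F f)"
  "obj_map id_functor X = X" "arr_map id_functor f = f"
  "comp_functor (comp_functor H G) F = comp_functor H (comp_functor G F)"
  "comp_functor id_functor F = F" "comp_functor F id_functor = F"
  by (simp_all add: comp_functor_def id_functor_def o_def)

context is_category
begin

definition arrow :: "'a \<Rightarrow> 'o \<Rightarrow> 'o \<Rightarrow> bool" where
  "arrow f X Y \<longleftrightarrow> f \<in> Arr C \<and> Dom C f = X \<and> Cod C f = Y"

abbreviation after :: "'a \<Rightarrow> 'a \<Rightarrow> 'a" (infixr "\<cdot>" 70) where "g \<cdot> f \<equiv> Comp C g f"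

lemma arrow_comp: "arrow f X Y \<Longrightarrow> arrow g Y Z \<Longrightarrow> arrow (g \<cdot> f) X Z"
  using comp_arr by (auto simp: arrow_def)

lemma arrow_assoc: "arrow f X Y \<Longrightarrow> arrow g Y Z \<Longrightarrow> arrow h Z W \<Longrightarrow> h \<cdot> g \<cdot> f = (h \<cdot> g) \<cdot> f"
  using comp_assoc by (auto simp: arrow_def)

lemma arrow_id: "X \<in> Obj C \<Longrightarrow> arrow (Id C X) X X"
  using id_arr by (auto simp: arrow_def)

lemma id_arrow: "arrow f X Y \<Longrightarrow> Id C Y \<cdot> f = f"
  using id_left by (auto simp: arrow_def)

lemma arrow_id_right: "arrow f X Y \<Longrightarrow> f \<cdot> Id C X = f"
  using id_right by (auto simp: arrow_def)

lemma arrow_obj: "arrow f X Y \<Longrightarrow> X \<in> Obj C" "arrow f X Y \<Longrightarrow> Y \<in> Obj C"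
  using dom_obj cod_obj by (auto simp: arrow_def)

lemma iso_arrE:
  assumes "is_iso_arr C f" "Dom C f = X" "Cod C f = Y"
  obtains g where "arrow f X Y" "arrow g Y X" "g \<cdot> f = Id C X" "f \<cdot> g = Id C Y"
  using assms by (auto simp: is_iso_arr_def arrow_def)

lemma iso_arrI:
  "arrow f X Y \<Longrightarrow> arrow g Y X \<Longrightarrow> g \<cdot> f = Id C X \<Longrightarrow> f \<cdot> g = Id C Y \<Longrightarrow> is_iso_arr C f"
  by (auto simp: is_iso_arr_def arrow_def)

lemma functor_arrow: "is_functor C C F \<Longrightarrow> arrow f X Y \<Longrightarrow> arrow (arr_map F f) (obj_map F X) (obj_map F Y)"
  by (auto simp: is_functor_def arrow_def)

lemma functor_comp:
  "is_functor C C F \<Longrightarrow> arrow f X Y \<Longrightarrow> arrow g Y Z \<Longrightarrow> arr_map F (g \<cdot> f) = arr_map F g \<cdot> arr_map F f"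
  by (auto simp: is_functor_def arrow_def)

lemma functor_id: "is_functor C C F \<Longrightarrow> X \<in> Obj C \<Longrightarrow> arr_map F (Id C X) = Id C (obj_map F X)"
  by (auto simp: is_functor_def)

lemma functor_obj: "is_functor C C F \<Longrightarrow> X \<in> Obj C \<Longrightarrow> obj_map F X \<in> Obj C"
  by (auto simp: is_functor_def)

lemma is_functor_id: "is_functor C C id_functor"
  by (auto simp: is_functor_def)

lemma is_functor_comp: "is_functor C C F \<Longrightarrow> is_functor C C G \<Longrightarrow> is_functor C C (comp_functor G F)"
  by (auto simp: is_functor_def)

lemma natural_iso_betweenE:
  assumes "natural_iso_between C \<eta> F G" "X \<in> Obj C"
  obtains \<theta> where "arrow (\<eta> X) (obj_map F X) (obj_map G X)" "arrow \<theta> (obj_map G X) (obj_map F X)"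
    "\<theta> \<cdot> \<eta> X = Id C (obj_map F X)" "\<eta> X \<cdot> \<theta> = Id C (obj_map G X)"
  using assms iso_arrE unfolding natural_iso_between_def by metis

lemma natural_iso_betweenI:
  assumes "\<And>X. X \<in> Obj C \<Longrightarrow> arrow (\<eta> X) (obj_map F X) (obj_map G X)"
    and "\<And>X. X \<in> Obj C \<Longrightarrow> arrow (\<theta> X) (obj_map G X) (obj_map F X)"
    and "\<And>X. X \<in> Obj C \<Longrightarrow> \<theta> X \<cdot> \<eta> X = Id C (obj_map F X)"
    and "\<And>X. X \<in> Obj C \<Longrightarrow> \<eta> X \<cdot> \<theta> X = Id C (obj_map G X)"
    and "\<And>f X Y. arrow f X Y \<Longrightarrow> \<eta> Y \<cdot> arr_map F f = arr_map G f \<cdot> \<eta> X"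
  shows "natural_iso_between C \<eta> F G"
  unfolding natural_iso_between_def
proof (intro conjI ballI)
  fix X assume X: "X \<in> Obj C"
  show "is_iso_arr C (\<eta> X)" by (rule iso_arrI) (use assms(1-4) X in auto)
  show "Dom C (\<eta> X) = obj_map F X" "Cod C (\<eta> X) = obj_map G X"
    using assms(1)[OF X] by (simp_all add: arrow_def)
qed (use assms(5) in \<open>simp add: arrow_def\<close>)

lemma natural_iso_between_natural:
  "natural_iso_between C \<eta> F G \<Longrightarrow> arrow f X Y \<Longrightarrow> \<eta> Y \<cdot> arr_map F f = arr_map G f \<cdot> \<eta> X"
  by (auto simp: natural_iso_between_def arrow_def)

lemma naturally_isomorphic_if_agree:
  assumes F: "is_functor C C F"
    and "\<And>X. X \<in> Obj C \<Longrightarrow> obj_map F X = obj_map G X"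
    and "\<And>f. f \<in> Arr C \<Longrightarrow> arr_map F f = arr_map G f"
  shows "naturally_isomorphic C C F G"
proof -
  have i: "arrow (Id C (obj_map F X)) (obj_map F X) (obj_map F X)" if "X \<in> Obj C" for X
    by (rule arrow_id[OF functor_obj[OF F that]])
  have "natural_iso_between C (\<lambda>X. Id C (obj_map F X)) F G"
  proof (rule natural_iso_betweenI)
    show "Id C (obj_map F Y) \<cdot> arr_map F f = arr_map G f \<cdot> Id C (obj_map F X)"
      if "arrow f X Y" for f X Y
      using id_arrow[OF functor_arrow[OF F that]] arrow_id_right[OF functor_arrow[OF F that]]
        that assms(3)[of f] by (simp add: arrow_def)
  qed (use i id_arrow[OF i] in \<open>simp_all add: assms(2)[symmetric]\<close>)
  then show ?thesis by (auto simp: naturally_isomorphic_iff)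
qed

lemma naturally_isomorphic_sym:
  assumes FG: "is_functor C C F" "is_functor C C G" and "naturally_isomorphic C C F G"
  shows "naturally_isomorphic C C G F"
proof -
  obtain \<eta> where \<eta>: "natural_iso_between C \<eta> F G"
    using assms by (auto simp: naturally_isomorphic_iff)
  have "\<exists>\<theta>. arrow (\<eta> X) (obj_map F X) (obj_map G X) \<and> arrow \<theta> (obj_map G X) (obj_map F X)
      \<and> \<theta> \<cdot> \<eta> X = Id C (obj_map F X) \<and> \<eta> X \<cdot> \<theta> = Id C (obj_map G X)" if "X \<in> Obj C" for X
    using natural_iso_betweenE[OF \<eta> that] by metis
  then obtain \<theta> where \<theta>: "\<And>X. X \<in> Obj C \<Longrightarrow> arrow (\<eta> X) (obj_map F X) (obj_map G X)
      \<and> arrow (\<theta> X) (obj_map G X) (obj_map F X)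
      \<and> \<theta> X \<cdot> \<eta> X = Id C (obj_map F X) \<and> \<eta> X \<cdot> \<theta> X = Id C (obj_map G X)"
    by metis
  show ?thesis
    unfolding naturally_isomorphic_iff
  proof (intro exI natural_iso_betweenI)
    fix f X Y assume f: "arrow f X Y"
    have X: "arrow (\<eta> X) (obj_map F X) (obj_map G X)" "arrow (\<theta> X) (obj_map G X) (obj_map F X)"
        "\<eta> X \<cdot> \<theta> X = Id C (obj_map G X)"
      and Y: "arrow (\<eta> Y) (obj_map F Y) (obj_map G Y)" "arrow (\<theta> Y) (obj_map G Y) (obj_map F Y)"
        "\<theta> Y \<cdot> \<eta> Y = Id C (obj_map F Y)"
      using \<theta>[OF arrow_obj(1)[OF f]] \<theta>[OF arrow_obj(2)[OF f]] by auto
    note Ff = functor_arrow[OF FG(1) f] and Gf = functor_arrow[OF FG(2) f]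
    note Ff\<theta> = arrow_comp[OF X(2) Ff]
    have "\<theta> Y \<cdot> arr_map G f = \<theta> Y \<cdot> (arr_map G f \<cdot> \<eta> X) \<cdot> \<theta> X"
      using arrow_assoc[OF X(2,1) Gf] X(3) arrow_id_right[OF Gf] by simp
    also have "\<dots> = \<theta> Y \<cdot> \<eta> Y \<cdot> arr_map F f \<cdot> \<theta> X"
      unfolding natural_iso_between_natural[OF \<eta> f, symmetric] arrow_assoc[OF X(2) Ff Y(1)] ..
    also have "\<dots> = arr_map F f \<cdot> \<theta> X"
      using arrow_assoc[OF Ff\<theta> Y(1,2)] Y(3) id_arrow[OF Ff\<theta>] by simp
    finally show "\<theta> Y \<cdot> arr_map G f = arr_map F f \<cdot> \<theta> X" .
  qed (use \<theta> in auto)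
qed

lemma naturally_isomorphic_trans:
  assumes F: "is_functor C C F" "is_functor C C G" "is_functor C C H"
    and "naturally_isomorphic C C F G" "naturally_isomorphic C C G H"
  shows "naturally_isomorphic C C F H"
proof -
  obtain \<eta> \<zeta> where \<eta>: "natural_iso_between C \<eta> F G" and \<zeta>: "natural_iso_between C \<zeta> G H"
    using assms by (auto simp: naturally_isomorphic_iff)
  have "natural_iso_between C (\<lambda>X. \<zeta> X \<cdot> \<eta> X) F H"
    unfolding natural_iso_between_def
  proof (intro conjI ballI)
    fix X assume X: "X \<in> Obj C"
    obtain \<theta> where \<theta>: "arrow (\<eta> X) (obj_map F X) (obj_map G X)" "arrow \<theta> (obj_map G X) (obj_map F X)"
      "\<theta> \<cdot> \<eta> X = Id C (obj_map F X)" "\<eta> X \<cdot> \<theta> = Id C (obj_map G X)"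
      by (rule natural_iso_betweenE[OF \<eta> X])
    obtain \<xi> where \<xi>: "arrow (\<zeta> X) (obj_map G X) (obj_map H X)" "arrow \<xi> (obj_map H X) (obj_map G X)"
      "\<xi> \<cdot> \<zeta> X = Id C (obj_map G X)" "\<zeta> X \<cdot> \<xi> = Id C (obj_map H X)"
      by (rule natural_iso_betweenE[OF \<zeta> X])
    have 1: "(\<theta> \<cdot> \<xi>) \<cdot> \<zeta> X \<cdot> \<eta> X = Id C (obj_map F X)"
      using arrow_assoc[OF arrow_comp[OF \<theta>(1) \<xi>(1)] \<xi>(2) \<theta>(2)] arrow_assoc[OF \<theta>(1) \<xi>(1,2)]
      by (simp add: \<theta> \<xi> id_arrow[OF \<theta>(1)])
    have 2: "(\<zeta> X \<cdot> \<eta> X) \<cdot> \<theta> \<cdot> \<xi> = Id C (obj_map H X)"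
      using arrow_assoc[OF arrow_comp[OF \<xi>(2) \<theta>(2)] \<theta>(1) \<xi>(1)] arrow_assoc[OF \<xi>(2) \<theta>(2,1)]
      by (simp add: \<theta> \<xi> id_arrow[OF \<xi>(2)])
    note a = arrow_comp[OF \<theta>(1) \<xi>(1)]
    show "is_iso_arr C (\<zeta> X \<cdot> \<eta> X)"
      by (rule iso_arrI[OF a arrow_comp[OF \<xi>(2) \<theta>(2)] 1 2])
    show "Dom C (\<zeta> X \<cdot> \<eta> X) = obj_map F X" "Cod C (\<zeta> X \<cdot> \<eta> X) = obj_map H X"
      using a by (auto simp: arrow_def)
  next
    fix f assume "f \<in> Arr C"
    then have f: "arrow f (Dom C f) (Cod C f)" by (simp add: arrow_def)
    let ?X = "Dom C f" and ?Y = "Cod C f"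
    note Ff = functor_arrow[OF F(1) f] and Gf = functor_arrow[OF F(2) f] and Hf = functor_arrow[OF F(3) f]
    have e: "arrow (\<eta> X) (obj_map F X) (obj_map G X)" "arrow (\<zeta> X) (obj_map G X) (obj_map H X)"
      if "X \<in> Obj C" for X
      using natural_iso_betweenE[OF \<eta> that] natural_iso_betweenE[OF \<zeta> that] by metis+
    note X = e[OF arrow_obj(1)[OF f]] and Y = e[OF arrow_obj(2)[OF f]]
    show "(\<zeta> ?Y \<cdot> \<eta> ?Y) \<cdot> arr_map F f = arr_map H f \<cdot> \<zeta> ?X \<cdot> \<eta> ?X"
      unfolding arrow_assoc[OF Ff Y, symmetric] natural_iso_between_natural[OF \<eta> f]
        arrow_assoc[OF X(1) Gf Y(2)] natural_iso_between_natural[OF \<zeta> f]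
      using arrow_assoc[OF X Hf] by simp
  qed
  then show ?thesis by (auto simp: naturally_isomorphic_iff)
qed

lemma naturally_isomorphic_comp_left:
  assumes F: "is_functor C C F" "is_functor C C G" "is_functor C C H"
    and "naturally_isomorphic C C F G"
  shows "naturally_isomorphic C C (comp_functor H F) (comp_functor H G)"
proof -
  obtain \<eta> where \<eta>: "natural_iso_between C \<eta> F G"
    using assms by (auto simp: naturally_isomorphic_iff)
  have "natural_iso_between C (\<lambda>X. arr_map H (\<eta> X)) (comp_functor H F) (comp_functor H G)"
    unfolding natural_iso_between_def
  proof (intro conjI ballI)
    fix X assume X: "X \<in> Obj C"
    obtain \<theta> where \<theta>: "arrow (\<eta> X) (obj_map F X) (obj_map G X)" "arrow \<theta> (obj_map G X) (obj_map F X)"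
      "\<theta> \<cdot> \<eta> X = Id C (obj_map F X)" "\<eta> X \<cdot> \<theta> = Id C (obj_map G X)"
      by (rule natural_iso_betweenE[OF \<eta> X])
    note a = functor_arrow[OF F(3) \<theta>(1)] and b = functor_arrow[OF F(3) \<theta>(2)]
    show "is_iso_arr C (arr_map H (\<eta> X))"
      by (rule iso_arrI[OF a b])
        (use functor_comp[OF F(3) \<theta>(1,2)] functor_comp[OF F(3) \<theta>(2,1)] \<theta>
          functor_id[OF F(3)] functor_obj[OF F(1) X] functor_obj[OF F(2) X] in simp_all)
    show "Dom C (arr_map H (\<eta> X)) = obj_map (comp_functor H F) X"
      "Cod C (arr_map H (\<eta> X)) = obj_map (comp_functor H G) X"
      using a by (auto simp: arrow_def)
  next
    fix f assume "f \<in> Arr C"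
    then have f: "arrow f (Dom C f) (Cod C f)" by (simp add: arrow_def)
    have e: "arrow (\<eta> X) (obj_map F X) (obj_map G X)" if "X \<in> Obj C" for X
      using natural_iso_betweenE[OF \<eta> that] by metis
    show "arr_map H (\<eta> (Cod C f)) \<cdot> arr_map (comp_functor H F) f
        = arr_map (comp_functor H G) f \<cdot> arr_map H (\<eta> (Dom C f))"
      using natural_iso_between_natural[OF \<eta> f]
        functor_comp[OF F(3) functor_arrow[OF F(1) f] e[OF arrow_obj(2)[OF f]]]
        functor_comp[OF F(3) e[OF arrow_obj(1)[OF f]] functor_arrow[OF F(2) f]]
      by simp
  qed
  then show ?thesis by (auto simp: naturally_isomorphic_iff)
qed

lemma naturally_isomorphic_comp_right:
  assumes H: "is_functor C C H" and "naturally_isomorphic C C F G"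
  shows "naturally_isomorphic C C (comp_functor F H) (comp_functor G H)"
proof -
  obtain \<eta> where \<eta>: "natural_iso_between C \<eta> F G"
    using assms by (auto simp: naturally_isomorphic_iff)
  then have "natural_iso_between C (\<lambda>X. \<eta> (obj_map H X)) (comp_functor F H) (comp_functor G H)"
    using H unfolding natural_iso_between_def is_functor_def comp_functor_simps by metis
  then show ?thesis by (auto simp: naturally_isomorphic_iff)
qed

lemma auto_equivalences_iff:
  "F \<in> auto_equivalences C \<longleftrightarrow> is_functor C C F \<and> (\<exists>G. is_functor C C G \<and>
     naturally_isomorphic C C (comp_functor G F) id_functor \<and>
     naturally_isomorphic C C (comp_functor F G) id_functor)"
  by (simp add: auto_equivalences_def is_equivalence_def)

lemma auto_equivalences_comp:
  assumes "F \<in> auto_equivalences C" "G \<in> auto_equivalences C"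
  shows "comp_functor F G \<in> auto_equivalences C"
proof -
  have cancel: "naturally_isomorphic C C (comp_functor (comp_functor K' H') (comp_functor H K)) id_functor"
    if "is_functor C C H" "is_functor C C H'" "is_functor C C K" "is_functor C C K'"
      "naturally_isomorphic C C (comp_functor H' H) id_functor"
      "naturally_isomorphic C C (comp_functor K' K) id_functor" for H H' K K'
  proof -
    have "naturally_isomorphic C C (comp_functor K' (comp_functor (comp_functor H' H) K))
        (comp_functor K' (comp_functor id_functor K))"
      using that by (intro naturally_isomorphic_comp_left naturally_isomorphic_comp_right
          is_functor_comp is_functor_id)
    then show ?thesis
      using that by (rule_tac naturally_isomorphic_trans[OF _ _ is_functor_id,
          of _ "comp_functor K' (comp_functor id_functor K)"]) (simp_all add: is_functor_comp)
  qed
  obtain F' where F: "is_functor C C F" "is_functor C C F'"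
      "naturally_isomorphic C C (comp_functor F' F) id_functor"
      "naturally_isomorphic C C (comp_functor F F') id_functor"
    using assms(1) unfolding auto_equivalences_iff by blast
  obtain G' where G: "is_functor C C G" "is_functor C C G'"
      "naturally_isomorphic C C (comp_functor G' G) id_functor"
      "naturally_isomorphic C C (comp_functor G G') id_functor"
    using assms(2) unfolding auto_equivalences_iff by blast
  show ?thesis
    unfolding auto_equivalences_iff
  proof (intro conjI exI[of _ "comp_functor G' F'"])
    show "naturally_isomorphic C C (comp_functor (comp_functor G' F') (comp_functor F G)) id_functor"
      by (rule cancel) (fact F G)+
    show "naturally_isomorphic C C (comp_functor (comp_functor F G) (comp_functor G' F')) id_functor"
      by (rule cancel) (fact F G)+
  qed (intro is_functor_comp F G)+
qed

lemma equiv_nat_iso_rel: "equiv (auto_equivalences C) (nat_iso_rel C)"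
proof (rule equivI)
  have fn: "is_functor C C F" if "F \<in> auto_equivalences C" for F
    using that by (simp add: auto_equivalences_iff)
  have "naturally_isomorphic C C F F" if "F \<in> auto_equivalences C" for F
    by (rule naturally_isomorphic_if_agree[OF fn[OF that] refl refl])
  then show "refl_on (auto_equivalences C) (nat_iso_rel C)"
    by (simp add: refl_on_def nat_iso_rel_def)
  show "nat_iso_rel C \<subseteq> auto_equivalences C \<times> auto_equivalences C"
    by (auto simp: nat_iso_rel_def)
  show "sym (nat_iso_rel C)"
  proof (rule symI)
    fix F G assume "(F, G) \<in> nat_iso_rel C"
    then show "(G, F) \<in> nat_iso_rel C"
      using fn naturally_isomorphic_sym[of F G] by (simp add: nat_iso_rel_def)
  qed
  show "trans (nat_iso_rel C)"
  proof (rule transI)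
    fix F G H assume "(F, G) \<in> nat_iso_rel C" "(G, H) \<in> nat_iso_rel C"
    then show "(F, H) \<in> nat_iso_rel C"
      using fn naturally_isomorphic_trans[of F G H] by (simp add: nat_iso_rel_def)
  qed
qed

lemma nat_iso_rel_comp:
  assumes "(F, F') \<in> nat_iso_rel C" "(G, G') \<in> nat_iso_rel C"
  shows "(comp_functor F G, comp_functor F' G') \<in> nat_iso_rel C"
proof -
  have f: "is_functor C C F" "is_functor C C F'" "is_functor C C G" "is_functor C C G'"
    using assms unfolding nat_iso_rel_def auto_equivalences_iff by blast+
  have "naturally_isomorphic C C (comp_functor F G) (comp_functor F G')"
    by (rule naturally_isomorphic_comp_left) (use assms f in \<open>simp_all add: nat_iso_rel_def\<close>)
  moreover have "naturally_isomorphic C C (comp_functor F G') (comp_functor F' G')"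
    by (rule naturally_isomorphic_comp_right) (use assms f in \<open>simp_all add: nat_iso_rel_def\<close>)
  ultimately have "naturally_isomorphic C C (comp_functor F G) (comp_functor F' G')"
    using f by (rule_tac naturally_isomorphic_trans[of _ "comp_functor F G'"]) (simp_all add: is_functor_comp)
  then show ?thesis using assms auto_equivalences_comp by (simp add: nat_iso_rel_def)
qed

lemma auto_equivalence_group_mult:
  assumes "F \<in> auto_equivalences C" "G \<in> auto_equivalences C"
  shows "nat_iso_rel C `` {F} \<otimes>\<^bsub>auto_equivalence_group C\<^esub> nat_iso_rel C `` {G}
    = nat_iso_rel C `` {comp_functor F G}"
proof -
  let ?cls = "\<lambda>F. nat_iso_rel C `` {F}"
  have const: "?cls (comp_functor F' G') = ?cls (comp_functor F G)"
    if "F' \<in> ?cls F" "G' \<in> ?cls G" for F' G'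
    using that nat_iso_rel_comp[of F F' G G'] equiv_class_eq[OF equiv_nat_iso_rel] by simp
  have "F \<in> ?cls F" "G \<in> ?cls G"
    by (rule equiv_class_self[OF equiv_nat_iso_rel]; rule assms)+
  then have "?cls F \<noteq> {}" "?cls G \<noteq> {}" by blast+
  have "?cls F \<otimes>\<^bsub>auto_equivalence_group C\<^esub> ?cls G
      = (\<Union>F'\<in>?cls F. \<Union>G'\<in>?cls G. ?cls (comp_functor F' G'))"
    by (simp add: auto_equivalence_group_def)
  also have "\<dots> = (\<Union>F'\<in>?cls F. \<Union>G'\<in>?cls G. ?cls (comp_functor F G))"
    by (intro SUP_cong refl const)
  also have "\<dots> = ?cls (comp_functor F G)"
    using \<open>?cls F \<noteq> {}\<close> \<open>?cls G \<noteq> {}\<close> by (simp only: UN_constant if_False)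
  finally show ?thesis .
qed

text \<open>
  The group axioms need no separate proof: the classes are a homomorphic image of the group \<open>K\<close>, because
  composition of functors respects natural isomorphism.
\<close>

theorem auto_equivalence_group_iso_if_representatives:
  fixes K :: "('k, 'l) monoid_scheme"
  assumes K: "group K"
    and T: "\<And>k. k \<in> carrier K \<Longrightarrow> T k \<in> auto_equivalences C"
    and one: "naturally_isomorphic C C (T \<one>\<^bsub>K\<^esub>) id_functor"
    and mult: "\<And>k l. k \<in> carrier K \<Longrightarrow> l \<in> carrier K \<Longrightarrow>
      naturally_isomorphic C C (comp_functor (T k) (T l)) (T (k \<otimes>\<^bsub>K\<^esub> l))"
    and distinct: "\<And>k l. k \<in> carrier K \<Longrightarrow> l \<in> carrier K \<Longrightarrow> naturally_isomorphic C C (T k) (T l) \<Longrightarrow> k = l"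
    and complete: "\<And>F. F \<in> auto_equivalences C \<Longrightarrow> \<exists>k\<in>carrier K. naturally_isomorphic C C F (T k)"
  shows "group (auto_equivalence_group C) \<and> auto_equivalence_group C \<cong> K"
proof -
  interpret K: group K by (rule K)
  let ?A = "auto_equivalence_group C"
  define h where "h k = nat_iso_rel C `` {T k}" for k
  have id: "id_functor \<in> auto_equivalences C"
    unfolding auto_equivalences_iff
    by (intro conjI exI[of _ id_functor] is_functor_id naturally_isomorphic_if_agree is_functor_comp) simp_all
  have eqI: "nat_iso_rel C `` {F} = nat_iso_rel C `` {G}"
    if "naturally_isomorphic C C F G" "F \<in> auto_equivalences C" "G \<in> auto_equivalences C" for F G
    using that by (intro equiv_class_eq[OF equiv_nat_iso_rel]) (simp add: nat_iso_rel_def)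
  have eqD: "naturally_isomorphic C C F G"
    if "nat_iso_rel C `` {F} = nat_iso_rel C `` {G}" "G \<in> auto_equivalences C" for F G
    using eq_equiv_class[OF that(1) equiv_nat_iso_rel that(2)] by (simp add: nat_iso_rel_def)
  have image: "h ` carrier K = carrier ?A"
  proof
    show "h ` carrier K \<subseteq> carrier ?A"
      using T by (auto simp: h_def auto_equivalence_group_def intro: quotientI)
    show "carrier ?A \<subseteq> h ` carrier K"
    proof
      fix A assume "A \<in> carrier ?A"
      then obtain F where F: "F \<in> auto_equivalences C" "A = nat_iso_rel C `` {F}"
        by (auto simp: auto_equivalence_group_def elim: quotientE)
      with complete obtain k where "k \<in> carrier K" "naturally_isomorphic C C F (T k)" by blast
      with F show "A \<in> h ` carrier K" using eqI T by (auto simp: h_def)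
    qed
  qed
  have "h (k \<otimes>\<^bsub>K\<^esub> l) = h k \<otimes>\<^bsub>?A\<^esub> h l" if "k \<in> carrier K" "l \<in> carrier K" for k l
    unfolding h_def auto_equivalence_group_mult[OF T[OF that(1)] T[OF that(2)]]
    using that mult by (intro eqI[symmetric] T auto_equivalences_comp) auto
  with image have hom: "h \<in> hom K ?A" by (auto simp: hom_def)
  have "h \<one>\<^bsub>K\<^esub> = \<one>\<^bsub>?A\<^esub>"
    using eqI[OF one T[OF K.one_closed] id] by (simp add: h_def auto_equivalence_group_def)
  then have "?A \<lparr>carrier := h ` carrier K, one := h \<one>\<^bsub>K\<^esub>\<rparr> = ?A"
    using image by simp
  with K.hom_imp_img_group[OF hom] have "group ?A" by simp
  moreover have "inj_on h (carrier K)"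
    using eqD T distinct by (auto simp: inj_on_def h_def)
  then have "K \<cong> ?A" using hom image by (auto simp: is_iso_def iso_def bij_betw_def)
  then have "?A \<cong> K" by (rule K.iso_sym)
  ultimately show ?thesis by blast
qed

text \<open>
  An equivalence is full, faithful and essentially surjective. Fullness comes from the faithfulness of
  the quasi-inverse \<open>G\<close>: the candidate preimage of \<open>k\<close> is \<open>G k\<close> transported along the isomorphism from
  \<open>G F\<close> to the identity, and its image agrees with \<open>k\<close> after applying \<open>G\<close>.
\<close>

lemma auto_equivalence_fully_faithful:
  assumes "F \<in> auto_equivalences C"
  shows auto_equivalence_faithful:
    "\<And>f g X Y. arrow f X Y \<Longrightarrow> arrow g X Y \<Longrightarrow> arr_map F f = arr_map F g \<Longrightarrow> f = g"
    and auto_equivalence_full: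
    "\<And>k X Y. X \<in> Obj C \<Longrightarrow> Y \<in> Obj C \<Longrightarrow> arrow k (obj_map F X) (obj_map F Y)
      \<Longrightarrow> \<exists>f. arrow f X Y \<and> arr_map F f = k"
    and auto_equivalence_essentially_surjective:
    "\<And>Y. Y \<in> Obj C \<Longrightarrow> \<exists>X e d. X \<in> Obj C \<and> arrow e (obj_map F X) Y \<and> arrow d Y (obj_map F X)
      \<and> d \<cdot> e = Id C (obj_map F X) \<and> e \<cdot> d = Id C Y"
proof -
  obtain G \<eta> \<epsilon> where F: "is_functor C C F" and G: "is_functor C C G"
    and \<eta>: "natural_iso_between C \<eta> (comp_functor G F) id_functor"
    and \<epsilon>: "natural_iso_between C \<epsilon> (comp_functor F G) id_functor"
    using assms by (auto simp: auto_equivalences_iff naturally_isomorphic_iff)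
  have faithful: "f = g"
    if K: "is_functor C C K" and L: "is_functor C C L"
      and \<nu>: "natural_iso_between C \<nu> (comp_functor L K) id_functor"
      and f: "arrow f X Y" and g: "arrow g X Y" and eq: "arr_map K f = arr_map K g" for K L \<nu> f g X Y
  proof -
    obtain \<theta> where \<theta>: "arrow (\<nu> X) (obj_map L (obj_map K X)) X" "arrow \<theta> X (obj_map L (obj_map K X))"
      "\<nu> X \<cdot> \<theta> = Id C X"
      using natural_iso_betweenE[OF \<nu> arrow_obj(1)[OF f]] by auto
    have "f \<cdot> \<nu> X = g \<cdot> \<nu> X"
      using natural_iso_between_natural[OF \<nu> f] natural_iso_between_natural[OF \<nu> g] eq by simp
    then have "f \<cdot> \<nu> X \<cdot> \<theta> = g \<cdot> \<nu> X \<cdot> \<theta>"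
      using arrow_assoc[OF \<theta>(2,1) f] arrow_assoc[OF \<theta>(2,1) g] by simp
    then show "f = g" using \<theta> f g arrow_id_right by simp
  qed
  show "f = g" if "arrow f X Y" "arrow g X Y" "arr_map F f = arr_map F g" for f g X Y
    by (rule faithful[OF F G \<eta> that])
  show "\<exists>f. arrow f X Y \<and> arr_map F f = k"
    if X: "X \<in> Obj C" and Y: "Y \<in> Obj C" and k: "arrow k (obj_map F X) (obj_map F Y)" for k X Y
  proof -
    obtain \<theta> where \<theta>: "arrow (\<eta> X) (obj_map G (obj_map F X)) X" "arrow \<theta> X (obj_map G (obj_map F X))"
      "\<theta> \<cdot> \<eta> X = Id C (obj_map G (obj_map F X))"
      using natural_iso_betweenE[OF \<eta> X] by auto
    obtain \<xi> where \<xi>: "arrow (\<eta> Y) (obj_map G (obj_map F Y)) Y" "arrow \<xi> Y (obj_map G (obj_map F Y))"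
      "\<xi> \<cdot> \<eta> Y = Id C (obj_map G (obj_map F Y))"
      using natural_iso_betweenE[OF \<eta> Y] by auto
    note Gk = functor_arrow[OF G k]
    note \<eta>Gk = arrow_comp[OF Gk \<xi>(1)]
    define f where "f = (\<eta> Y \<cdot> arr_map G k) \<cdot> \<theta>"
    have f: "arrow f X Y" unfolding f_def by (rule arrow_comp[OF \<theta>(2) \<eta>Gk])
    note GFf = functor_arrow[OF G functor_arrow[OF F f]]
    have "\<eta> Y \<cdot> arr_map G (arr_map F f) = f \<cdot> \<eta> X"
      using natural_iso_between_natural[OF \<eta> f] by simp
    also have "\<dots> = \<eta> Y \<cdot> arr_map G k"
      unfolding f_def arrow_assoc[OF \<theta>(1,2) \<eta>Gk, symmetric] \<theta>(3) by (rule arrow_id_right[OF \<eta>Gk])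
    finally have "\<xi> \<cdot> \<eta> Y \<cdot> arr_map G (arr_map F f) = \<xi> \<cdot> \<eta> Y \<cdot> arr_map G k" by simp
    then have "arr_map G (arr_map F f) = arr_map G k"
      using arrow_assoc[OF GFf \<xi>(1,2)] arrow_assoc[OF Gk \<xi>(1,2)] \<xi>(3) id_arrow[OF GFf] id_arrow[OF Gk] by simp
    then have "arr_map F f = k"
      by (rule faithful[OF G F \<epsilon> functor_arrow[OF F f] k])
    with f show ?thesis by blast
  qed
  show "\<exists>X e d. X \<in> Obj C \<and> arrow e (obj_map F X) Y \<and> arrow d Y (obj_map F X)
      \<and> d \<cdot> e = Id C (obj_map F X) \<and> e \<cdot> d = Id C Y" if "Y \<in> Obj C" for Y
    using natural_iso_betweenE[OF \<epsilon> that] functor_obj[OF G that] by (metis comp_functor_simps(1,3))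
qed

end

section \<open>Equivariant maps and functors between categories of actions\<close>

lemma action_set_simps:
  assumes "is_action_set M X"
  shows action_set_one: "x \<in> carrier X \<Longrightarrow> act X \<one>\<^bsub>M\<^esub> x = x"
    and action_set_mult: "m \<in> carrier M \<Longrightarrow> n \<in> carrier M \<Longrightarrow> x \<in> carrier X \<Longrightarrow>
      act X (m \<otimes>\<^bsub>M\<^esub> n) x = act X m (act X n x)"
  using assms by (auto simp: is_action_set_def)

lemma equivariant_mapsD:
  assumes "f \<in> equivariant_maps M X Y"
  shows equivariant_closed: "x \<in> carrier X \<Longrightarrow> f x \<in> carrier Y"
    and equivariant_act: "m \<in> carrier M \<Longrightarrow> x \<in> carrier X \<Longrightarrow> f (act X m x) = act Y m (f x)"
    and equivariant_extensional: "f \<in> extensional (carrier X)"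
  using assms by (auto simp: equivariant_maps_def PiE_def)

lemma equivariant_eqI:
  assumes "f \<in> equivariant_maps M X Y" "g \<in> equivariant_maps M X Z"
    and "\<And>x. x \<in> carrier X \<Longrightarrow> f x = g x"
  shows "f = g"
  using assms by (intro extensionalityI[of _ "carrier X"]) (simp_all add: equivariant_maps_def PiE_def)

lemma compose_eqD:
  assumes "compose A f g = compose A f' g'" "x \<in> A"
  shows "f (g x) = f' (g' x)"
  using fun_cong[OF assms(1), of x] assms(2) by (simp add: compose_def)

lemma compose_eq_idD:
  assumes "compose A f g = restrict (\<lambda>x. x) A" "x \<in> A"
  shows "f (g x) = x"
  using fun_cong[OF assms(1), of x] assms(2) by (simp add: compose_def)

lemma equivariant_inverse:
  assumes X: "is_action_set M X" and f: "f \<in> equivariant_maps M X Y" and bij: "bij_betw f (carrier X) (carrier Y)"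
  shows "restrict (inv_into (carrier X) f) (carrier Y) \<in> equivariant_maps M Y X"
proof -
  let ?g = "inv_into (carrier X) f"
  have g: "?g y \<in> carrier X" "f (?g y) = y" if "y \<in> carrier Y" for y
    using bij that by (auto simp: bij_betw_def inv_into_into f_inv_into_f)
  have "act Y m y \<in> carrier Y \<and> ?g (act Y m y) = act X m (?g y)"
    if "m \<in> carrier M" "y \<in> carrier Y" for m y
  proof -
    have m: "act X m (?g y) \<in> carrier X" using X g that by (simp add: act_closed)
    have fm: "f (act X m (?g y)) = act Y m y"
      using f g that by (simp add: equivariant_act)
    then have "?g (act Y m y) = act X m (?g y)"
      using bij m by (metis bij_betw_imp_inj_on inv_into_f_f)
    with fm m f show ?thesis using equivariant_closed by metis
  qed
  with g show ?thesis by (auto simp: equivariant_maps_def)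
qed

context
  fixes M :: "('m, 'b) monoid_scheme" and U :: "'u set set"
begin

interpretation C: is_category "action_category M U" by (rule action_category_is_category)

lemma action_category_Obj: "X \<in> Obj (action_category M U) \<longleftrightarrow> is_action_set M X \<and> carrier X \<in> U"
  by (simp add: action_category_def)

lemma action_category_arrow:
  "C.arrow t X Y \<longleftrightarrow> X \<in> Obj (action_category M U) \<and> Y \<in> Obj (action_category M U)
    \<and> (\<exists>f. f \<in> equivariant_maps M X Y \<and> t = (X, f, Y))"
  unfolding C.arrow_def by (auto simp: action_category_def)

lemma action_category_Comp: "Comp (action_category M U) (Y, g, Z) (X, f, W) = (X, compose (carrier X) g f, Z)"
  by (simp add: action_category_def)

lemma action_category_Id: "Id (action_category M U) X = (X, restrict (\<lambda>x. x) (carrier X), X)"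
  by (simp add: action_category_def)

end

text \<open>
  An arrow of the category of actions is a triple of source, function and target. Only the function is
  not already determined by the action of the functor on objects.
\<close>

definition fun_map :: "(('m, 'u) action_set, ('m, 'u) action_arrow, ('m, 'u) action_set, ('m, 'u) action_arrow) functor_data
    \<Rightarrow> ('m, 'u) action_set \<Rightarrow> ('m, 'u) action_set \<Rightarrow> ('u \<Rightarrow> 'u) \<Rightarrow> 'u \<Rightarrow> 'u" where
  "fun_map F X Y f = fst (snd (arr_map F (X, f, Y)))"

locale action_functor =
  fixes M :: "('m, 'b) monoid_scheme" and U :: "'u set set" and F
  assumes functorial: "is_functor (action_category M U) (action_category M U) F"
begin

sublocale C: is_category "action_category M U" by (rule action_category_is_category)

abbreviation OB where "OB \<equiv> Obj (action_category M U)"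

lemma obj_map_OB: "X \<in> OB \<Longrightarrow> obj_map F X \<in> OB"
  by (rule C.functor_obj[OF functorial])

lemma
  assumes "X \<in> OB" "Y \<in> OB" "f \<in> equivariant_maps M X Y"
  shows arr_map_eq: "arr_map F (X, f, Y) = (obj_map F X, fun_map F X Y f, obj_map F Y)"
    and fun_map_equivariant: "fun_map F X Y f \<in> equivariant_maps M (obj_map F X) (obj_map F Y)"
proof -
  have "C.arrow (arr_map F (X, f, Y)) (obj_map F X) (obj_map F Y)"
    by (rule C.functor_arrow[OF functorial]) (use assms in \<open>simp add: action_category_arrow\<close>)
  then show "arr_map F (X, f, Y) = (obj_map F X, fun_map F X Y f, obj_map F Y)"
    "fun_map F X Y f \<in> equivariant_maps M (obj_map F X) (obj_map F Y)"
    by (auto simp: action_category_arrow fun_map_def)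
qed

lemma fun_map_compose:
  assumes "X \<in> OB" "Y \<in> OB" "Z \<in> OB" "f \<in> equivariant_maps M X Y" "g \<in> equivariant_maps M Y Z"
    and "x \<in> carrier (obj_map F X)"
  shows "fun_map F X Z (compose (carrier X) g f) x = fun_map F Y Z g (fun_map F X Y f x)"
proof -
  have f: "C.arrow (X, f, Y) X Y" and g: "C.arrow (Y, g, Z) Y Z"
    using assms by (simp_all add: action_category_arrow)
  have "arr_map F (X, compose (carrier X) g f, Z) = Comp (action_category M U) (arr_map F (Y, g, Z)) (arr_map F (X, f, Y))"
    using C.functor_comp[OF functorial f g] by (simp add: action_category_Comp)
  moreover have "compose (carrier X) g f \<in> equivariant_maps M X Z"
    using assms by (intro equivariant_compose[OF _ assms(4,5)]) (simp add: action_category_Obj)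
  ultimately have "fun_map F X Z (compose (carrier X) g f)
      = compose (carrier (obj_map F X)) (fun_map F Y Z g) (fun_map F X Y f)"
    using assms(1-5) by (simp add: arr_map_eq action_category_Comp)
  then show ?thesis using assms(6) by (simp add: compose_def)
qed

lemma fun_map_id:
  assumes "X \<in> OB" "x \<in> carrier (obj_map F X)"
  shows "fun_map F X X (restrict (\<lambda>x. x) (carrier X)) x = x"
  using C.functor_id[OF functorial assms(1)] assms by (simp add: fun_map_def action_category_Id)

end

lemma action_functors_naturally_isomorphicI:
  fixes M :: "('m, 'b) monoid_scheme" and U :: "'u set set"
  assumes "action_functor M U F" "action_functor M U G"
    and \<eta>: "\<And>X. X \<in> Obj (action_category M U) \<Longrightarrow> \<eta> X \<in> equivariant_maps M (obj_map F X) (obj_map G X)"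
    and bij: "\<And>X. X \<in> Obj (action_category M U) \<Longrightarrow> bij_betw (\<eta> X) (carrier (obj_map F X)) (carrier (obj_map G X))"
    and natural: "\<And>X Y f x. X \<in> Obj (action_category M U) \<Longrightarrow> Y \<in> Obj (action_category M U) \<Longrightarrow>
      f \<in> equivariant_maps M X Y \<Longrightarrow> x \<in> carrier (obj_map F X) \<Longrightarrow>
      \<eta> Y (fun_map F X Y f x) = fun_map G X Y f (\<eta> X x)"
  shows "naturally_isomorphic (action_category M U) (action_category M U) F G"
proof -
  interpret F: action_functor M U F by (rule assms)
  interpret G: action_functor M U G by (rule assms)
  let ?\<theta> = "\<lambda>X. restrict (inv_into (carrier (obj_map F X)) (\<eta> X)) (carrier (obj_map G X))"
  have obj: "is_action_set M X" "is_action_set M (obj_map F X)" "is_action_set M (obj_map G X)"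
    if "X \<in> F.OB" for X
    using that F.obj_map_OB[OF that] G.obj_map_OB[OF that] by (simp_all add: action_category_Obj)
  have "natural_iso_between (action_category M U) (\<lambda>X. (obj_map F X, \<eta> X, obj_map G X)) F G"
  proof (rule F.C.natural_iso_betweenI)
    fix X assume X: "X \<in> F.OB"
    note \<theta> = equivariant_inverse[OF obj(2)[OF X] \<eta>[OF X] bij[OF X]]
    show "F.C.arrow (obj_map F X, \<eta> X, obj_map G X) (obj_map F X) (obj_map G X)"
      using \<eta> X F.obj_map_OB G.obj_map_OB by (simp add: action_category_arrow)
    show "F.C.arrow (obj_map G X, ?\<theta> X, obj_map F X) (obj_map G X) (obj_map F X)"
      using \<theta> X F.obj_map_OB G.obj_map_OB by (simp add: action_category_arrow)
    have "?\<theta> X (\<eta> X x) = x" if "x \<in> carrier (obj_map F X)" for x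
      using that bij[OF X] \<eta>[OF X] by (simp add: equivariant_closed bij_betw_def)
    then show "Comp (action_category M U) (obj_map G X, ?\<theta> X, obj_map F X) (obj_map F X, \<eta> X, obj_map G X)
        = Id (action_category M U) (obj_map F X)"
      by (simp add: action_category_Comp action_category_Id compose_def cong: restrict_cong)
    have "\<eta> X (?\<theta> X x) = x" if "x \<in> carrier (obj_map G X)" for x
      using that bij[OF X] by (simp add: bij_betw_def f_inv_into_f)
    then show "Comp (action_category M U) (obj_map F X, \<eta> X, obj_map G X) (obj_map G X, ?\<theta> X, obj_map F X)
        = Id (action_category M U) (obj_map G X)"
      by (simp add: action_category_Comp action_category_Id compose_def cong: restrict_cong)
  next
    fix t X Y assume "F.C.arrow t X Y"
    then obtain f where X: "X \<in> F.OB" and Y: "Y \<in> F.OB" and f: "f \<in> equivariant_maps M X Y" and t: "t = (X, f, Y)"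
      by (auto simp: action_category_arrow)
    have "compose (carrier (obj_map F X)) (\<eta> Y) (fun_map F X Y f) = compose (carrier (obj_map F X)) (fun_map G X Y f) (\<eta> X)"
      using natural[OF X Y f] by (simp add: compose_def cong: restrict_cong)
    then show "Comp (action_category M U) (obj_map F Y, \<eta> Y, obj_map G Y) (arr_map F t)
        = Comp (action_category M U) (arr_map G t) (obj_map F X, \<eta> X, obj_map G X)"
      unfolding t F.arr_map_eq[OF X Y f] G.arr_map_eq[OF X Y f] action_category_Comp by simp
  qed
  then show ?thesis unfolding naturally_isomorphic_iff by blast
qed

section \<open>Twisting an action by a monoid endomorphism\<close>

text \<open>
  Restriction of scalars along \<open>\<alpha>\<close>, made extensional again.
\<close>

definition twist_set :: "('m, 'b) monoid_scheme \<Rightarrow> ('m \<Rightarrow> 'm) \<Rightarrow> ('m, 'u) action_set \<Rightarrow> ('m, 'u) action_set" where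
  "twist_set M \<alpha> X = \<lparr>carrier = carrier X, act = (\<lambda>m\<in>carrier M. act X (\<alpha> m))\<rparr>"

definition twist_functor :: "('m, 'b) monoid_scheme \<Rightarrow> ('m \<Rightarrow> 'm) \<Rightarrow>
    (('m, 'u) action_set, ('m, 'u) action_arrow, ('m, 'u) action_set, ('m, 'u) action_arrow) functor_data" where
  "twist_functor M \<alpha> =
     \<lparr>obj_map = twist_set M \<alpha>, arr_map = (\<lambda>(X, f, Y). (twist_set M \<alpha> X, f, twist_set M \<alpha> Y))\<rparr>"

lemma twist_set_simps [simp]:
  "carrier (twist_set M \<alpha> X) = carrier X"
  "m \<in> carrier M \<Longrightarrow> act (twist_set M \<alpha> X) m = act X (\<alpha> m)"
  by (simp_all add: twist_set_def)

lemma twist_functor_simps [simp]: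
  "obj_map (twist_functor M \<alpha>) = twist_set M \<alpha>"
  "arr_map (twist_functor M \<alpha>) (X, f, Y) = (twist_set M \<alpha> X, f, twist_set M \<alpha> Y)"
  "fun_map (twist_functor M \<alpha>) X Y f = f"
  by (simp_all add: twist_functor_def fun_map_def)

lemma twist_set_twist_set:
  "\<alpha> \<in> carrier M \<rightarrow> carrier M \<Longrightarrow> twist_set M \<alpha> (twist_set M \<beta> X) = twist_set M (\<beta> \<circ> \<alpha>) X"
  by (auto simp: twist_set_def intro!: restrict_ext)

lemma twist_set_cong: "(\<And>m. m \<in> carrier M \<Longrightarrow> \<alpha> m = \<beta> m) \<Longrightarrow> twist_set M \<alpha> X = twist_set M \<beta> X"
  by (auto simp: twist_set_def intro!: restrict_ext)

lemma twist_set_id: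
  assumes "is_action_set M X" and "\<And>m. m \<in> carrier M \<Longrightarrow> \<alpha> m = m"
  shows "twist_set M \<alpha> X = X"
proof -
  have "(\<lambda>m\<in>carrier M. act X (\<alpha> m)) = act X"
    using assms by (intro extensionalityI[of _ "carrier M"]) (auto simp: is_action_set_def PiE_def)
  then show ?thesis by (simp add: twist_set_def)
qed

locale monoid_endomorphism = monoid M for M (structure) +
  fixes \<alpha> :: "'a \<Rightarrow> 'a"
  assumes hom: "\<alpha> \<in> hom M M" and one: "\<alpha> \<one> = \<one>"
begin

lemma closed: "m \<in> carrier M \<Longrightarrow> \<alpha> m \<in> carrier M"
  using hom by (auto simp: hom_def)

lemma mult: "m \<in> carrier M \<Longrightarrow> n \<in> carrier M \<Longrightarrow> \<alpha> (m \<otimes> n) = \<alpha> m \<otimes> \<alpha> n"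
  using hom by (auto simp: hom_def)

lemma twist_set_is_action_set:
  assumes X: "is_action_set M X"
  shows "is_action_set M (twist_set M \<alpha> X)"
proof -
  have "act X (\<alpha> m) \<in> carrier X \<rightarrow>\<^sub>E carrier X" if "m \<in> carrier M" for m
    using X closed[OF that] unfolding is_action_set_def by (blast intro: PiE_mem)
  then have "act (twist_set M \<alpha> X) \<in> carrier M \<rightarrow>\<^sub>E (carrier X \<rightarrow>\<^sub>E carrier X)"
    by (simp add: twist_set_def)
  then show ?thesis
    using X by (simp add: is_action_set_def closed one mult)
qed

lemma twist_equivariant: "f \<in> equivariant_maps M X Y \<Longrightarrow> f \<in> equivariant_maps M (twist_set M \<alpha> X) (twist_set M \<alpha> Y)"
  using closed by (auto simp: equivariant_maps_def)

lemma twist_functor_is_functor: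
  "is_functor (action_category M U) (action_category M U) (twist_functor M \<alpha>)"
  unfolding is_functor_def action_category_def
  by (simp add: split_beta twist_set_is_action_set twist_equivariant)

end

lemma comp_twist_functor:
  assumes \<alpha>: "monoid_endomorphism M \<alpha>" and \<beta>: "monoid_endomorphism M \<beta>" and \<gamma>: "monoid_endomorphism M \<gamma>"
    and eq: "\<And>m. m \<in> carrier M \<Longrightarrow> \<beta> (\<alpha> m) = \<gamma> m"
  shows "naturally_isomorphic (action_category M U) (action_category M U)
    (comp_functor (twist_functor M \<alpha>) (twist_functor M \<beta>)) (twist_functor M \<gamma>)"
proof -
  interpret C: is_category "action_category M U" by (rule action_category_is_category)
  interpret \<alpha>: monoid_endomorphism M \<alpha> by (rule \<alpha>)
  interpret \<beta>: monoid_endomorphism M \<beta> by (rule \<beta>)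
  have "twist_set M \<alpha> (twist_set M \<beta> X) = twist_set M \<gamma> X" for X :: "('a, 'c) action_set"
    using eq by (subst twist_set_twist_set) (auto simp: \<alpha>.closed intro!: twist_set_cong)
  then show ?thesis
    using C.is_functor_comp[OF \<beta>.twist_functor_is_functor \<alpha>.twist_functor_is_functor]
    by (intro C.naturally_isomorphic_if_agree) (simp_all add: twist_functor_def split_beta)
qed

lemma twist_functor_identity:
  assumes \<alpha>: "monoid_endomorphism M \<alpha>" and eq: "\<And>m. m \<in> carrier M \<Longrightarrow> \<alpha> m = m"
  shows "naturally_isomorphic (action_category M U) (action_category M U) (twist_functor M \<alpha>) id_functor"
proof -
  interpret C: is_category "action_category M U" by (rule action_category_is_category)
  interpret \<alpha>: monoid_endomorphism M \<alpha> by (rule \<alpha>)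
  show ?thesis
    using \<alpha>.twist_functor_is_functor twist_set_id[where \<alpha> = \<alpha>, OF _ eq]
    by (intro C.naturally_isomorphic_if_agree) (auto simp: action_category_def twist_functor_def)
qed

lemma twist_functor_auto_equivalence:
  assumes \<alpha>: "monoid_endomorphism M \<alpha>" and \<beta>: "monoid_endomorphism M \<beta>"
    and inverse: "\<And>m. m \<in> carrier M \<Longrightarrow> \<beta> (\<alpha> m) = m" "\<And>m. m \<in> carrier M \<Longrightarrow> \<alpha> (\<beta> m) = m"
  shows "twist_functor M \<alpha> \<in> auto_equivalences (action_category M U)"
proof -
  interpret C: is_category "action_category M U" by (rule action_category_is_category)
  interpret \<alpha>: monoid_endomorphism M \<alpha> by (rule \<alpha>)
  interpret \<beta>: monoid_endomorphism M \<beta> by (rule \<beta>)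
  have id: "monoid_endomorphism M (\<lambda>m. m)"
    by unfold_locales (auto simp: hom_def)
  \<comment> \<open>Restriction of scalars is contravariant: twisting by \<open>\<delta>\<close> and then by \<open>\<gamma>\<close> is twisting by \<open>\<delta> \<circ> \<gamma>\<close>.\<close>
  have cancel: "naturally_isomorphic (action_category M U) (action_category M U)
      (comp_functor (twist_functor M \<gamma>) (twist_functor M \<delta>)) id_functor"
    if \<gamma>: "monoid_endomorphism M \<gamma>" and \<delta>: "monoid_endomorphism M \<delta>"
      and eq: "\<And>m. m \<in> carrier M \<Longrightarrow> \<delta> (\<gamma> m) = m" for \<gamma> \<delta>
    by (rule C.naturally_isomorphic_trans[OF _ _ C.is_functor_id comp_twist_functor[OF \<gamma> \<delta> id eq] twist_functor_identity[OF id]])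
      (intro C.is_functor_comp monoid_endomorphism.twist_functor_is_functor \<gamma> \<delta> id | simp)+
  show ?thesis
    unfolding C.auto_equivalences_iff
    by (intro conjI exI[of _ "twist_functor M \<beta>"] \<alpha>.twist_functor_is_functor \<beta>.twist_functor_is_functor
        cancel \<alpha> \<beta> inverse)
qed

section \<open>Auto-equivalences and the regular action\<close>

text \<open>
  The objects of the category are sets of elements of the type \<open>'u\<close>, which need not contain \<open>M\<close>. An
  injection \<open>code\<close> with small image puts a copy of the left regular action of \<open>M\<close> among them.
\<close>

locale regular_action = monoid M for M :: "('m, 'b) monoid_scheme" (structure) +
  fixes U :: "'u set set" and code :: "'m \<Rightarrow> 'u"
  assumes subset_closed: "S \<in> U \<Longrightarrow> T \<subseteq> S \<Longrightarrow> T \<in> U"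
    and code_small: "code ` carrier M \<in> U"
    and code_inj: "inj_on code (carrier M)"
begin

definition decode :: "'u \<Rightarrow> 'm" where "decode = the_inv_into (carrier M) code"

lemma decode_code [simp]: "m \<in> carrier M \<Longrightarrow> decode (code m) = m"
  by (simp add: decode_def the_inv_into_f_f code_inj)

definition regular :: "('m, 'u) action_set" where
  "regular = \<lparr>carrier = code ` carrier M,
     act = (\<lambda>m\<in>carrier M. \<lambda>x\<in>code ` carrier M. code (m \<otimes> decode x))\<rparr>"

lemma carrier_regular: "carrier regular = code ` carrier M"
  by (simp add: regular_def)

lemma act_regular: "m \<in> carrier M \<Longrightarrow> n \<in> carrier M \<Longrightarrow> act regular m (code n) = code (m \<otimes> n)"
  by (simp add: regular_def)

lemma code_closed: "m \<in> carrier M \<Longrightarrow> code m \<in> carrier regular"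
  by (simp add: carrier_regular)

lemma carrier_regularE:
  assumes "x \<in> carrier regular" obtains m where "m \<in> carrier M" "x = code m"
  using assms by (auto simp: carrier_regular)

lemma regular_is_action_set: "is_action_set M regular"
  unfolding is_action_set_def
proof (intro conjI ballI)
  show "act regular \<in> carrier M \<rightarrow>\<^sub>E (carrier regular \<rightarrow>\<^sub>E carrier regular)"
    by (auto simp: regular_def)
qed (auto elim!: carrier_regularE simp: act_regular m_assoc)

lemma regular_OB: "regular \<in> Obj (action_category M U)"
  by (simp add: action_category_Obj regular_is_action_set carrier_regular code_small)

text \<open>
  The maps \<open>orbit_map X x\<close> are exactly the equivariant maps from the regular action to \<open>X\<close>: the
  regular action is free on the unit of \<open>M\<close> and represents the underlying set functor.
\<close>

definition orbit_map :: "('m, 'u) action_set \<Rightarrow> 'u \<Rightarrow> 'u \<Rightarrow> 'u" where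
  "orbit_map X x = (\<lambda>z\<in>carrier regular. act X (decode z) x)"

lemma orbit_map_code: "m \<in> carrier M \<Longrightarrow> orbit_map X x (code m) = act X m x"
  by (simp add: orbit_map_def code_closed)

lemma orbit_map_one: "is_action_set M X \<Longrightarrow> x \<in> carrier X \<Longrightarrow> orbit_map X x (code \<one>) = x"
  by (simp add: orbit_map_code action_set_one)

lemma orbit_map_equivariant:
  assumes "is_action_set M X" "x \<in> carrier X"
  shows "orbit_map X x \<in> equivariant_maps M regular X"
proof -
  have "orbit_map X x \<in> carrier regular \<rightarrow>\<^sub>E carrier X"
    using assms by (auto simp: orbit_map_def carrier_regular act_closed)
  then show ?thesis
    using assms by (auto simp: equivariant_maps_def act_regular orbit_map_code action_set_mult elim!: carrier_regularE)
qed

lemma equivariant_from_regular: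
  assumes "f \<in> equivariant_maps M regular X" "m \<in> carrier M"
  shows "f (code m) = act X m (f (code \<one>))"
proof -
  have "f (act regular m (code \<one>)) = act X m (f (code \<one>))"
    using assms code_closed by (intro equivariant_act[OF assms(1)]) auto
  then show ?thesis using assms by (simp add: act_regular)
qed

text \<open>
  Naturality of the correspondence between elements and maps from the regular action.
\<close>

lemma compose_orbit_map:
  assumes "is_action_set M X" "x \<in> carrier X" "f \<in> equivariant_maps M X Y"
  shows "compose (carrier regular) f (orbit_map X x) = orbit_map Y (f x)"
  unfolding compose_def orbit_map_def
  using assms by (intro restrict_ext) (auto simp: equivariant_act elim!: carrier_regularE)

end

locale action_auto_equivalence = regular_action M U code
  for M :: "('m, 'b) monoid_scheme" (structure) and U :: "'u set set" and code +
  fixes F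
  assumes F: "F \<in> auto_equivalences (action_category M U)"
    and trivial_idempotents: "e \<in> carrier M \<Longrightarrow> e \<otimes> e = e \<Longrightarrow> e = \<one>"
begin

sublocale action_functor M U F
proof
  interpret C: is_category "action_category M U" by (rule action_category_is_category)
  show "is_functor (action_category M U) (action_category M U) F"
    using F by (simp add: C.auto_equivalences_iff)
qed

lemma OB_is_action_set: "X \<in> OB \<Longrightarrow> is_action_set M X"
  by (simp add: action_category_Obj)

lemma fun_map_inject:
  assumes "X \<in> OB" "Y \<in> OB" "f \<in> equivariant_maps M X Y" "g \<in> equivariant_maps M X Y"
    and "\<And>x. x \<in> carrier (obj_map F X) \<Longrightarrow> fun_map F X Y f x = fun_map F X Y g x"
  shows "f = g"
proof -
  have "fun_map F X Y f = fun_map F X Y g"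
    by (rule equivariant_eqI[OF fun_map_equivariant[OF assms(1-3)] fun_map_equivariant[OF assms(1,2,4)] assms(5)])
  then have eq: "arr_map F (X, f, Y) = arr_map F (X, g, Y)"
    using assms(1-4) by (simp add: arr_map_eq)
  have "C.arrow (X, f, Y) X Y" "C.arrow (X, g, Y) X Y"
    using assms(1-4) by (simp_all add: action_category_arrow)
  then have "(X, f, Y) = (X, g, Y)"
    using C.auto_equivalence_faithful[OF F _ _ eq] by blast
  then show ?thesis by simp
qed

lemma fun_map_surject:
  assumes "X \<in> OB" "Y \<in> OB" "k \<in> equivariant_maps M (obj_map F X) (obj_map F Y)"
  obtains f where "f \<in> equivariant_maps M X Y" "fun_map F X Y f = k"
proof -
  have "C.arrow (obj_map F X, k, obj_map F Y) (obj_map F X) (obj_map F Y)"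
    using assms obj_map_OB by (simp add: action_category_arrow)
  then obtain t where t: "C.arrow t X Y" "arr_map F t = (obj_map F X, k, obj_map F Y)"
    using C.auto_equivalence_full[OF F assms(1,2)] by blast
  from t(1) obtain f where "f \<in> equivariant_maps M X Y" "t = (X, f, Y)"
    unfolding action_category_arrow by blast
  with t(2) show thesis
    by (intro that[of f]) (simp_all add: fun_map_def)
qed

text \<open>
  Essential surjectivity at the regular action, in terms of elements: \<open>\<rho>\<close> is an isomorphism from
  \<open>F P\<close> to the regular action, and \<open>p\<close> is the free generator of \<open>F P\<close> that it sends to the unit.
\<close>

lemma regular_in_essential_image:
  obtains P p \<rho> where "P \<in> OB" "p \<in> carrier (obj_map F P)"
    "\<rho> \<in> equivariant_maps M (obj_map F P) regular"
    "\<rho> p = code \<one>" "\<And>w. w \<in> carrier (obj_map F P) \<Longrightarrow> orbit_map (obj_map F P) p (\<rho> w) = w"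
proof -
  obtain P e d where P: "P \<in> OB" "C.arrow e (obj_map F P) regular" "C.arrow d regular (obj_map F P)"
    and de: "Comp (action_category M U) d e = Id (action_category M U) (obj_map F P)"
    and ed: "Comp (action_category M U) e d = Id (action_category M U) regular"
    using C.auto_equivalence_essentially_surjective[OF F regular_OB] by blast
  obtain \<rho> \<sigma> where \<rho>: "e = (obj_map F P, \<rho>, regular)" "\<rho> \<in> equivariant_maps M (obj_map F P) regular"
    and \<sigma>: "d = (regular, \<sigma>, obj_map F P)" "\<sigma> \<in> equivariant_maps M regular (obj_map F P)"
    using P(2,3) unfolding action_category_arrow by blast
  have \<sigma>\<rho>: "\<sigma> (\<rho> w) = w" if "w \<in> carrier (obj_map F P)" for w
    by (rule compose_eq_idD[OF _ that]) (use de in \<open>simp add: \<rho> \<sigma> action_category_Comp action_category_Id\<close>)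
  have \<rho>\<sigma>: "\<rho> (\<sigma> z) = z" if "z \<in> carrier regular" for z
    by (rule compose_eq_idD[OF _ that]) (use ed in \<open>simp add: \<rho> \<sigma> action_category_Comp action_category_Id\<close>)
  let ?p = "\<sigma> (code \<one>)"
  have "orbit_map (obj_map F P) ?p (\<rho> w) = w" if w: "w \<in> carrier (obj_map F P)" for w
  proof -
    obtain m where m: "m \<in> carrier M" "\<rho> w = code m"
      using equivariant_closed[OF \<rho>(2) w] by (rule carrier_regularE)
    have "orbit_map (obj_map F P) ?p (\<rho> w) = \<sigma> (code m)"
      unfolding m(2) orbit_map_code[OF m(1)] by (rule equivariant_from_regular[OF \<sigma>(2) m(1), symmetric])
    then show ?thesis using \<sigma>\<rho>[OF w] m(2) by simp
  qed
  then show thesis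
    using equivariant_closed[OF \<sigma>(2)] \<rho>\<sigma> by (intro that[of P ?p \<rho>] P(1) \<rho>(2)) (simp_all add: code_closed)
qed

text \<open>
  If \<open>k m = 1\<close>, then \<open>m k\<close> is idempotent and therefore \<open>1\<close>.
\<close>

lemma one_sided_inverse_unit:
  assumes "k \<in> carrier M" "m \<in> carrier M" "k \<otimes> m = \<one>"
  shows "m \<in> Units M"
proof -
  have "(m \<otimes> k) \<otimes> (m \<otimes> k) = m \<otimes> (k \<otimes> m) \<otimes> k"
    using assms(1,2) by (simp add: m_assoc)
  also have "\<dots> = m \<otimes> k" using assms by simp
  finally have "m \<otimes> k = \<one>" using assms by (intro trivial_idempotents) simp_all
  with assms show ?thesis by (auto simp: Units_def)
qed

text \<open>
  The largest proper subobject of the regular action: a subobject that contains a unit contains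
  everything. That the nonunits are closed under the action rests on one-sided inverses being
  two-sided.
\<close>

definition nonunits :: "('m, 'u) action_set" where
  "nonunits = \<lparr>carrier = code ` (carrier M - Units M),
     act = (\<lambda>m\<in>carrier M. \<lambda>x\<in>code ` (carrier M - Units M). act regular m x)\<rparr>"

lemma nonunits_OB: "nonunits \<in> OB"
proof -
  have closed: "m \<otimes> n \<notin> Units M" if "m \<in> carrier M" "n \<in> carrier M" "n \<notin> Units M" for m n
  proof
    assume "m \<otimes> n \<in> Units M"
    then have inv: "inv (m \<otimes> n) \<in> carrier M" by (rule Units_inv_closed)
    with that have "(inv (m \<otimes> n) \<otimes> m) \<otimes> n = inv (m \<otimes> n) \<otimes> (m \<otimes> n)"
      by (simp add: m_assoc)
    also have "\<dots> = \<one>" by (rule Units_l_inv) fact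
    finally show False
      using that inv one_sided_inverse_unit[of "inv (m \<otimes> n) \<otimes> m" n] by simp
  qed
  have act_code: "act nonunits m (code n) = code (m \<otimes> n)"
    if "m \<in> carrier M" "n \<in> carrier M" "n \<notin> Units M" for m n
    using that by (simp add: nonunits_def act_regular)
  have "is_action_set M nonunits"
    unfolding is_action_set_def
  proof (intro conjI ballI)
    show "act nonunits \<in> carrier M \<rightarrow>\<^sub>E (carrier nonunits \<rightarrow>\<^sub>E carrier nonunits)"
      using closed by (auto simp: nonunits_def act_regular intro!: imageI)
  next
    fix x assume "x \<in> carrier nonunits"
    then obtain n where "n \<in> carrier M" "n \<notin> Units M" "x = code n"
      by (auto simp: nonunits_def)
    then show "act nonunits \<one> x = x" by (simp add: act_code)
  next
    fix k m x assume km: "k \<in> carrier M" "m \<in> carrier M" and "x \<in> carrier nonunits"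
    then obtain n where "n \<in> carrier M" "n \<notin> Units M" "x = code n"
      by (auto simp: nonunits_def)
    with km closed[of m n] show "act nonunits (k \<otimes> m) x = act nonunits k (act nonunits m x)"
      by (simp add: act_code m_assoc)
  qed
  moreover have "carrier nonunits \<in> U"
    by (rule subset_closed[OF code_small]) (auto simp: nonunits_def)
  ultimately show ?thesis by (simp add: action_category_Obj)
qed

lemma nonunits_inclusion: "restrict (\<lambda>x. x) (carrier nonunits) \<in> equivariant_maps M nonunits regular"
proof -
  have "act nonunits m x \<in> carrier nonunits" if "m \<in> carrier M" "x \<in> carrier nonunits" for m x
    by (rule act_closed[OF OB_is_action_set[OF nonunits_OB] that])
  then show ?thesis
    by (auto simp: equivariant_maps_def) (auto simp: nonunits_def carrier_regular)
qed

text \<open>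
  Suppose every map from \<open>P\<close> to the regular action \<open>R\<close> lands in the subobject \<open>N\<close> of nonunits.
  As \<open>F P\<close> is isomorphic to \<open>R\<close>, every element of \<open>F R\<close> is hit by \<open>F h\<close> for some map \<open>h\<close> from \<open>P\<close>
  to \<open>R\<close>, and \<open>h\<close> factors through \<open>N\<close>; so \<open>F\<close> sends the inclusion of \<open>N\<close> to a surjection. The
  image is also injective, since elements of \<open>F N\<close> are images of maps from \<open>P\<close> to \<open>N\<close> and \<open>F\<close> is faithful.
  Being an isomorphism is reflected by \<open>F\<close>, so the inclusion of \<open>N\<close> would be an isomorphism, although
  \<open>N\<close> omits the unit.
\<close>

lemma map_hitting_unit:
  assumes P: "P \<in> OB" "p \<in> carrier (obj_map F P)"
    and \<rho>: "\<rho> \<in> equivariant_maps M (obj_map F P) regular" "\<rho> p = code \<one>"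
  shows "\<exists>h\<in>equivariant_maps M P regular. \<exists>g\<in>carrier P. h g \<in> code ` Units M"
proof (rule ccontr)
  assume none: "\<not> ?thesis"
  let ?N = nonunits
  let ?\<iota> = "restrict (\<lambda>x. x) (carrier ?N)"
  note R = regular_OB and N = nonunits_OB and \<iota> = nonunits_inclusion
  have FR: "is_action_set M (obj_map F regular)" and FN: "is_action_set M (obj_map F ?N)"
    and isP: "is_action_set M P" and FP: "is_action_set M (obj_map F P)"
    using obj_map_OB R N P OB_is_action_set by blast+
  \<comment> \<open>An element \<open>y\<close> of \<open>F Y\<close> is a map from \<open>F P\<close> to \<open>F Y\<close> taking the generator \<open>p\<close> to \<open>y\<close>, hence \<open>F k\<close> for
    some \<open>k\<close>.\<close>
  have lift: "\<exists>k. k \<in> equivariant_maps M P Y \<and> fun_map F P Y k = compose (carrier (obj_map F P)) (orbit_map (obj_map F Y) y) \<rho>"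
    if "Y \<in> OB" "y \<in> carrier (obj_map F Y)" for Y y
    by (rule fun_map_surject[OF P(1) that(1)
          equivariant_compose[OF FP \<rho>(1) orbit_map_equivariant[OF OB_is_action_set[OF obj_map_OB[OF that(1)]] that(2)]]])
      blast
  have lift_p: "compose (carrier (obj_map F P)) (orbit_map (obj_map F Y) y) \<rho> p = y"
    if "Y \<in> OB" "y \<in> carrier (obj_map F Y)" for Y y
    using that P \<rho> OB_is_action_set obj_map_OB by (simp add: compose_def orbit_map_one)
  have surj: "\<exists>x\<in>carrier (obj_map F ?N). fun_map F ?N regular ?\<iota> x = y" if y: "y \<in> carrier (obj_map F regular)" for y
  proof -
    obtain h where h: "h \<in> equivariant_maps M P regular"
      and Fh: "fun_map F P regular h = compose (carrier (obj_map F P)) (orbit_map (obj_map F regular) y) \<rho>"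
      using lift[OF R y] by blast
    have into: "h g \<in> carrier ?N" if "g \<in> carrier P" for g
      using equivariant_closed[OF h that] none h that by (auto simp: nonunits_def carrier_regular)
    have act_N: "act ?N m z = act regular m z" if "m \<in> carrier M" "z \<in> carrier ?N" for m z
      using that by (simp add: nonunits_def)
    have h': "h \<in> equivariant_maps M P ?N"
      using h into by (auto simp: equivariant_maps_def act_N PiE_def)
    have "compose (carrier P) ?\<iota> h = h"
      by (rule extensionalityI[of _ "carrier P"]) (use h into in \<open>auto simp: equivariant_extensional compose_def\<close>)
    then have "fun_map F ?N regular ?\<iota> (fun_map F P ?N h p) = y"
      using fun_map_compose[OF P(1) N R h' \<iota> P(2)] Fh lift_p[OF R y] by simp
    moreover have "fun_map F P ?N h p \<in> carrier (obj_map F ?N)"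
      by (rule equivariant_closed[OF fun_map_equivariant[OF P(1) N h'] P(2)])
    ultimately show ?thesis by blast
  qed
  have F\<iota>: "fun_map F ?N regular ?\<iota> \<in> equivariant_maps M (obj_map F ?N) (obj_map F regular)"
    by (rule fun_map_equivariant[OF N R \<iota>])
  have inj: "a = b"
    if a: "a \<in> carrier (obj_map F ?N)" and b: "b \<in> carrier (obj_map F ?N)"
      and eq: "fun_map F ?N regular ?\<iota> a = fun_map F ?N regular ?\<iota> b" for a b
  proof -
    obtain k where k: "k \<in> equivariant_maps M P ?N"
      and Fk: "fun_map F P ?N k = compose (carrier (obj_map F P)) (orbit_map (obj_map F ?N) a) \<rho>"
      using lift[OF N a] by blast
    obtain l where l: "l \<in> equivariant_maps M P ?N"
      and Fl: "fun_map F P ?N l = compose (carrier (obj_map F P)) (orbit_map (obj_map F ?N) b) \<rho>"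
      using lift[OF N b] by blast
    have "compose (carrier P) ?\<iota> k = compose (carrier P) ?\<iota> l"
    proof (rule fun_map_inject[OF P(1) R equivariant_compose[OF isP k \<iota>] equivariant_compose[OF isP l \<iota>]])
      fix w assume w: "w \<in> carrier (obj_map F P)"
      obtain m where m: "m \<in> carrier M" "\<rho> w = code m"
        using equivariant_closed[OF \<rho>(1) w] by (rule carrier_regularE)
      have "fun_map F ?N regular ?\<iota> (fun_map F P ?N k w) = fun_map F ?N regular ?\<iota> (fun_map F P ?N l w)"
        using w m a b eq by (simp add: Fk Fl compose_def orbit_map_code equivariant_act[OF F\<iota>])
      then show "fun_map F P regular (compose (carrier P) ?\<iota> k) w = fun_map F P regular (compose (carrier P) ?\<iota> l) w"
        using fun_map_compose[OF P(1) N R k \<iota> w] fun_map_compose[OF P(1) N R l \<iota> w] by simp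
    qed
    then have "k x = l x" if "x \<in> carrier P" for x
      using compose_eqD[OF _ that] equivariant_closed[OF k that] equivariant_closed[OF l that] by fastforce
    then have "k = l" by (rule equivariant_eqI[OF k l])
    then show "a = b" using Fk Fl lift_p[OF N a] lift_p[OF N b] by simp
  qed
  have bij: "bij_betw (fun_map F ?N regular ?\<iota>) (carrier (obj_map F ?N)) (carrier (obj_map F regular))"
    unfolding bij_betw_def
  proof
    show "inj_on (fun_map F ?N regular ?\<iota>) (carrier (obj_map F ?N))"
      using inj by (rule inj_onI)
    show "fun_map F ?N regular ?\<iota> ` carrier (obj_map F ?N) = carrier (obj_map F regular)"
    proof (intro equalityI subsetI)
      fix y assume "y \<in> carrier (obj_map F regular)"
      then show "y \<in> fun_map F ?N regular ?\<iota> ` carrier (obj_map F ?N)"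
        using surj by (metis imageI)
    qed (use equivariant_closed[OF F\<iota>] in blast)
  qed
  \<comment> \<open>A map \<open>j\<close> whose image under \<open>F\<close> inverts the image of the inclusion is a section of the inclusion.\<close>
  let ?j = "restrict (inv_into (carrier (obj_map F ?N)) (fun_map F ?N regular ?\<iota>)) (carrier (obj_map F regular))"
  obtain j where j: "j \<in> equivariant_maps M regular ?N" and Fj: "fun_map F regular ?N j = ?j"
    using fun_map_surject[OF R N equivariant_inverse[OF FN F\<iota> bij]] by blast
  have isR: "is_action_set M regular" by (rule regular_is_action_set)
  have "compose (carrier regular) ?\<iota> j = restrict (\<lambda>x. x) (carrier regular)"
  proof (rule fun_map_inject[OF R R equivariant_compose[OF isR j \<iota>] equivariant_id[OF isR]])
    fix y assume y: "y \<in> carrier (obj_map F regular)"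
    then have "fun_map F regular regular (compose (carrier regular) ?\<iota> j) y
        = fun_map F ?N regular ?\<iota> (?j y)"
      using fun_map_compose[OF R N R j \<iota> y] Fj by simp
    also have "\<dots> = y"
      using bij y by (simp add: bij_betw_def f_inv_into_f)
    also have "y = fun_map F regular regular (restrict (\<lambda>x. x) (carrier regular)) y"
      using fun_map_id[OF R y] by simp
    finally show "fun_map F regular regular (compose (carrier regular) ?\<iota> j) y
        = fun_map F regular regular (restrict (\<lambda>x. x) (carrier regular)) y" .
  qed
  moreover have one: "code \<one> \<in> carrier regular" by (simp add: code_closed)
  ultimately have "?\<iota> (j (code \<one>)) = code \<one>"
    by (rule compose_eq_idD)
  then have "code \<one> \<in> carrier ?N"
    using equivariant_closed[OF j one] by simp
  then show False
    using code_inj Units_one_closed by (auto simp: nonunits_def inj_on_def)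
qed

end

context action_auto_equivalence
begin

text \<open>
  A map \<open>h\<close> that hits a unit is surjective and splits over the free object, by a map \<open>s\<close>. Applying \<open>F\<close>
  and the isomorphism \<open>\<rho>\<close> makes \<open>F R\<close> a retract of the regular action \<open>R\<close>, with projection
  \<open>m \<mapsto> m u\<close> and section \<open>b\<close>. The composite endomorphism of \<open>R\<close> is right multiplication by \<open>b u\<close>,
  which is idempotent, so \<open>b u = 1\<close> and the retract is all of \<open>R\<close>.
\<close>

lemma image_of_regular_free:
  obtains u where "u \<in> carrier (obj_map F regular)"
    "bij_betw (\<lambda>m. act (obj_map F regular) m u) (carrier M) (carrier (obj_map F regular))"
proof -
  obtain P p \<rho> where P: "P \<in> OB" "p \<in> carrier (obj_map F P)"
    and \<rho>: "\<rho> \<in> equivariant_maps M (obj_map F P) regular" "\<rho> p = code \<one>"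
    and orbit: "\<And>w. w \<in> carrier (obj_map F P) \<Longrightarrow> orbit_map (obj_map F P) p (\<rho> w) = w"
    by (rule regular_in_essential_image) blast
  obtain h g v where h: "h \<in> equivariant_maps M P regular" and g: "g \<in> carrier P"
    and v: "v \<in> Units M" "h g = code v"
    using map_hitting_unit[OF P \<rho>] by blast
  note R = regular_OB and isR = regular_is_action_set
  have isP: "is_action_set M P" and FR: "is_action_set M (obj_map F regular)"
    and FP: "is_action_set M (obj_map F P)"
    using obj_map_OB R P OB_is_action_set by blast+
  \<comment> \<open>Dividing by the unit \<open>v\<close> gives a preimage of \<open>1\<close> itself, which determines a section of \<open>h\<close>.\<close>
  define g' where "g' = act P (inv v) g"
  have g': "g' \<in> carrier P" unfolding g'_def using isP g v by (simp add: act_closed)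
  have hg': "h g' = code \<one>"
    unfolding g'_def using v g by (simp add: equivariant_act[OF h] act_regular Units_closed)
  define s where "s = orbit_map P g'"
  have s: "s \<in> equivariant_maps M regular P"
    unfolding s_def by (rule orbit_map_equivariant[OF isP g'])
  have "compose (carrier regular) h s = orbit_map regular (code \<one>)"
    unfolding s_def hg'[symmetric] by (rule compose_orbit_map[OF isP g' h])
  also have "\<dots> = restrict (\<lambda>x. x) (carrier regular)"
    unfolding orbit_map_def by (intro restrict_ext) (auto elim!: carrier_regularE simp: act_regular)
  finally have hs: "compose (carrier regular) h s = restrict (\<lambda>x. x) (carrier regular)" .
  note Fh = fun_map_equivariant[OF P(1) R h] and Fs = fun_map_equivariant[OF R P(1) s]
  define u where "u = fun_map F P regular h p"
  have u: "u \<in> carrier (obj_map F regular)"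
    unfolding u_def by (rule equivariant_closed[OF Fh P(2)])
  have split: "fun_map F P regular h (fun_map F regular P s y) = y" if "y \<in> carrier (obj_map F regular)" for y
    using fun_map_compose[OF R P(1) R s h that] fun_map_id[OF R that] hs by simp
  define b where "b y = decode (\<rho> (fun_map F regular P s y))" for y
  have b: "b y \<in> carrier M" "code (b y) = \<rho> (fun_map F regular P s y)" if y: "y \<in> carrier (obj_map F regular)" for y
  proof -
    obtain m where "m \<in> carrier M" "\<rho> (fun_map F regular P s y) = code m"
      using equivariant_closed[OF \<rho>(1) equivariant_closed[OF Fs y]] by (rule carrier_regularE)
    then show "b y \<in> carrier M" "code (b y) = \<rho> (fun_map F regular P s y)"
      by (simp_all add: b_def)
  qed
  have retract: "act (obj_map F regular) (b y) u = y" if y: "y \<in> carrier (obj_map F regular)" for y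
  proof -
    let ?w = "fun_map F regular P s y"
    have w: "?w \<in> carrier (obj_map F P)" by (rule equivariant_closed[OF Fs y])
    have "act (obj_map F P) (b y) p = orbit_map (obj_map F P) p (code (b y))"
      by (rule orbit_map_code[OF b(1)[OF y], symmetric])
    also have "\<dots> = ?w" unfolding b(2)[OF y] by (rule orbit[OF w])
    finally have "act (obj_map F P) (b y) p = ?w" .
    then have "fun_map F P regular h (act (obj_map F P) (b y) p) = y"
      using split[OF y] by simp
    then show ?thesis
      unfolding u_def equivariant_act[OF Fh b(1)[OF y] P(2)] .
  qed
  have b_act: "b (act (obj_map F regular) m y) = m \<otimes> b y"
    if m: "m \<in> carrier M" and y: "y \<in> carrier (obj_map F regular)" for m y
  proof -
    have "\<rho> (fun_map F regular P s (act (obj_map F regular) m y)) = act regular m (code (b y))"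
      using m y equivariant_closed[OF Fs y]
      by (simp add: equivariant_act[OF Fs] equivariant_act[OF \<rho>(1)] b)
    also have "\<dots> = code (m \<otimes> b y)" by (rule act_regular[OF m b(1)[OF y]])
    finally have "b (act (obj_map F regular) m y) = decode (code (m \<otimes> b y))"
      by (simp only: b_def)
    then show ?thesis using m b(1)[OF y] by simp
  qed
  have "b u \<otimes> b u = b (act (obj_map F regular) (b u) u)"
    using b_act b u by simp
  also have "\<dots> = b u" using retract[OF u] by simp
  finally have "b u = \<one>" using b(1)[OF u] by (intro trivial_idempotents)
  then have inverse: "b (act (obj_map F regular) m u) = m" if "m \<in> carrier M" for m
    using b_act[OF that u] that by simp
  have "bij_betw (\<lambda>m. act (obj_map F regular) m u) (carrier M) (carrier (obj_map F regular))"
    by (rule bij_betw_byWitness[where f' = b])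
      (use inverse retract b act_closed[OF FR] u in auto)
  with u show thesis by (rule that)
qed

text \<open>
  The bijection \<open>\<theta>\<close> is the composite \<open>X \<cong> Hom(R, X) \<cong> Hom(F R, F X) \<cong> F X\<close>, where \<open>R\<close> is the regular
  action and the last step evaluates at the free generator \<open>u\<close>. Right multiplication by \<open>m\<close> on \<open>R\<close>
  is sent by \<open>F\<close> to the endomorphism of \<open>F R\<close> with \<open>u \<mapsto> \<alpha> m \<cdot> u\<close>. This defines \<open>\<alpha>\<close>, and the
  equation for \<open>\<theta>\<close> follows because the map \<open>R \<rightarrow> X\<close> of \<open>m x\<close> is that of \<open>x\<close> after right
  multiplication by \<open>m\<close>.
\<close>

theorem auto_equivalence_is_twist:
  obtains \<alpha> \<theta> where "\<alpha> \<in> iso M M"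
    "\<And>X. X \<in> OB \<Longrightarrow> bij_betw (\<theta> X) (carrier X) (carrier (obj_map F X))"
    "\<And>X m x. X \<in> OB \<Longrightarrow> m \<in> carrier M \<Longrightarrow> x \<in> carrier X \<Longrightarrow>
      \<theta> X (act X m x) = act (obj_map F X) (\<alpha> m) (\<theta> X x)"
    "\<And>X Y f x. X \<in> OB \<Longrightarrow> Y \<in> OB \<Longrightarrow> f \<in> equivariant_maps M X Y \<Longrightarrow> x \<in> carrier X \<Longrightarrow>
      \<theta> Y (f x) = fun_map F X Y f (\<theta> X x)"
proof -
  obtain u where u: "u \<in> carrier (obj_map F regular)"
    and free: "bij_betw (\<lambda>m. act (obj_map F regular) m u) (carrier M) (carrier (obj_map F regular))"
    by (rule image_of_regular_free)
  note R = regular_OB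
  have FR: "is_action_set M (obj_map F regular)"
    by (rule OB_is_action_set[OF obj_map_OB[OF R]])
  have inj_u: "m = n" if "m \<in> carrier M" "n \<in> carrier M"
      "act (obj_map F regular) m u = act (obj_map F regular) n u" for m n
    using free that by (auto simp: bij_betw_def inj_on_def)
  have surj_u: "\<exists>m\<in>carrier M. y = act (obj_map F regular) m u" if "y \<in> carrier (obj_map F regular)" for y
    using free that by (auto simp: bij_betw_def image_iff)
  define \<theta> where "\<theta> X x = fun_map F regular X (orbit_map X x) u" for X x
  have F_orbit: "fun_map F regular X (orbit_map X x) \<in> equivariant_maps M (obj_map F regular) (obj_map F X)"
    if "X \<in> OB" "x \<in> carrier X" for X x
    by (rule fun_map_equivariant[OF R that(1) orbit_map_equivariant[OF OB_is_action_set[OF that(1)] that(2)]])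
  have \<theta>_closed: "\<theta> X x \<in> carrier (obj_map F X)" if "X \<in> OB" "x \<in> carrier X" for X x
    unfolding \<theta>_def by (rule equivariant_closed[OF F_orbit[OF that] u])
  have natural: "\<theta> Y (f x) = fun_map F X Y f (\<theta> X x)"
    if "X \<in> OB" "Y \<in> OB" "f \<in> equivariant_maps M X Y" "x \<in> carrier X" for X Y f x
  proof -
    have isX: "is_action_set M X" by (rule OB_is_action_set[OF that(1)])
    show ?thesis
      unfolding \<theta>_def compose_orbit_map[OF isX that(4,3), symmetric]
      by (rule fun_map_compose[OF R that(1,2) orbit_map_equivariant[OF isX that(4)] that(3) u])
  qed
  have inj: "x = y" if X: "X \<in> OB" and x: "x \<in> carrier X" and y: "y \<in> carrier X" and eq: "\<theta> X x = \<theta> X y" for X x y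
  proof -
    have isX: "is_action_set M X" by (rule OB_is_action_set[OF X])
    have "orbit_map X x = orbit_map X y"
    proof (rule fun_map_inject[OF R X orbit_map_equivariant[OF isX x] orbit_map_equivariant[OF isX y]])
      fix w assume w: "w \<in> carrier (obj_map F regular)"
      obtain m where m: "m \<in> carrier M" "w = act (obj_map F regular) m u" using surj_u[OF w] by blast
      show "fun_map F regular X (orbit_map X x) w = fun_map F regular X (orbit_map X y) w"
        unfolding m(2) equivariant_act[OF F_orbit[OF X x] m(1) u] equivariant_act[OF F_orbit[OF X y] m(1) u]
        using eq by (simp only: \<theta>_def)
    qed
    then have "orbit_map X x (code \<one>) = orbit_map X y (code \<one>)" by (rule fun_cong)
    then show "x = y" unfolding orbit_map_one[OF isX x] orbit_map_one[OF isX y] .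
  qed
  have surj: "\<exists>x\<in>carrier X. \<theta> X x = y" if X: "X \<in> OB" and y: "y \<in> carrier (obj_map F X)" for X y
  proof -
    have isX: "is_action_set M X" and FX: "is_action_set M (obj_map F X)"
      using X obj_map_OB OB_is_action_set by blast+
    \<comment> \<open>The map from \<open>F R\<close> with \<open>u \<mapsto> y\<close>, which exists because \<open>u\<close> generates freely.\<close>
    define k where "k = (\<lambda>w\<in>carrier (obj_map F regular). act (obj_map F X) (the_inv_into (carrier M) (\<lambda>m. act (obj_map F regular) m u) w) y)"
    have k_act: "k (act (obj_map F regular) m u) = act (obj_map F X) m y" if "m \<in> carrier M" for m
      using the_inv_into_f_f[OF bij_betw_imp_inj_on[OF free] that] act_closed[OF FR that u] by (simp add: k_def)
    have k: "k \<in> equivariant_maps M (obj_map F regular) (obj_map F X)"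
    proof -
      have "k w \<in> carrier (obj_map F X)" if w: "w \<in> carrier (obj_map F regular)" for w
      proof -
        obtain n where n: "n \<in> carrier M" "w = act (obj_map F regular) n u" using surj_u[OF w] by blast
        show ?thesis unfolding n(2) k_act[OF n(1)] by (rule act_closed[OF FX n(1) y])
      qed
      moreover have "k (act (obj_map F regular) m w) = act (obj_map F X) m (k w)"
        if m: "m \<in> carrier M" and w: "w \<in> carrier (obj_map F regular)" for m w
      proof -
        obtain n where n: "n \<in> carrier M" "w = act (obj_map F regular) n u" using surj_u[OF w] by blast
        show ?thesis
          unfolding n(2) k_act[OF n(1)] action_set_mult[OF FR m n(1) u, symmetric]
            k_act[OF m_closed[OF m n(1)]] by (rule action_set_mult[OF FX m n(1) y])
      qed
      moreover have "k \<in> extensional (carrier (obj_map F regular))" by (simp add: k_def)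
      ultimately show ?thesis by (simp add: equivariant_maps_def PiE_def Pi_iff)
    qed
    obtain f where f: "f \<in> equivariant_maps M regular X" "fun_map F regular X f = k"
      by (rule fun_map_surject[OF R X k])
    let ?x = "f (code \<one>)"
    have x: "?x \<in> carrier X" by (rule equivariant_closed[OF f(1)]) (simp add: code_closed)
    have "f = orbit_map X ?x"
    proof (rule equivariant_eqI[OF f(1) orbit_map_equivariant[OF isX x]])
      fix z assume "z \<in> carrier regular"
      then obtain m where m: "m \<in> carrier M" "z = code m" by (rule carrier_regularE)
      show "f z = orbit_map X ?x z"
        unfolding m(2) orbit_map_code[OF m(1)] by (rule equivariant_from_regular[OF f(1) m(1)])
    qed
    then have "\<theta> X ?x = k u" unfolding \<theta>_def using f(2) by metis
    also have "\<dots> = y"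
      using k_act[OF one_closed] u y by (simp add: action_set_one[OF FR] action_set_one[OF FX])
    finally show ?thesis using x by blast
  qed
  have "\<exists>a\<in>carrier M. \<theta> regular (code m) = act (obj_map F regular) a u" if "m \<in> carrier M" for m
    by (rule surj_u[OF \<theta>_closed[OF R code_closed[OF that]]])
  then obtain \<alpha> where \<alpha>: "\<And>m. m \<in> carrier M \<Longrightarrow> \<alpha> m \<in> carrier M"
    "\<And>m. m \<in> carrier M \<Longrightarrow> \<theta> regular (code m) = act (obj_map F regular) (\<alpha> m) u"
    by metis
  have twisted: "\<theta> X (act X m x) = act (obj_map F X) (\<alpha> m) (\<theta> X x)"
    if "X \<in> OB" "m \<in> carrier M" "x \<in> carrier X" for X m x
  proof -
    have isX: "is_action_set M X" by (rule OB_is_action_set[OF that(1)])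
    have "\<theta> X (act X m x) = \<theta> X (orbit_map X x (code m))"
      using that by (simp add: orbit_map_code)
    also have "\<dots> = fun_map F regular X (orbit_map X x) (\<theta> regular (code m))"
      by (rule natural[OF R that(1) orbit_map_equivariant[OF isX that(3)] code_closed[OF that(2)]])
    also have "\<dots> = act (obj_map F X) (\<alpha> m) (\<theta> X x)"
      unfolding \<alpha>(2)[OF that(2)] equivariant_act[OF F_orbit[OF that(1,3)] \<alpha>(1)[OF that(2)] u]
      by (simp only: \<theta>_def)
    finally show ?thesis .
  qed
  have mult: "\<alpha> (m \<otimes> n) = \<alpha> m \<otimes> \<alpha> n" if m: "m \<in> carrier M" and n: "n \<in> carrier M" for m n
  proof (rule inj_u)
    have "act (obj_map F regular) (\<alpha> (m \<otimes> n)) u = \<theta> regular (act regular m (code n))"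
      using m n by (simp add: \<alpha>(2) act_regular)
    also have "\<dots> = act (obj_map F regular) (\<alpha> m) (act (obj_map F regular) (\<alpha> n) u)"
      using twisted[OF R m code_closed[OF n]] n by (simp add: \<alpha>(2))
    also have "\<dots> = act (obj_map F regular) (\<alpha> m \<otimes> \<alpha> n) u"
      using m n u by (simp add: action_set_mult[OF FR] \<alpha>(1))
    finally show "act (obj_map F regular) (\<alpha> (m \<otimes> n)) u = act (obj_map F regular) (\<alpha> m \<otimes> \<alpha> n) u" .
  qed (use m n \<alpha>(1) in simp_all)
  have "bij_betw \<alpha> (carrier M) (carrier M)"
    unfolding bij_betw_def
  proof
    show "inj_on \<alpha> (carrier M)"
    proof (rule inj_onI)
      fix m n assume m: "m \<in> carrier M" and n: "n \<in> carrier M" and "\<alpha> m = \<alpha> n"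
      then have "code m = code n"
        using inj[OF R code_closed[OF m] code_closed[OF n]] by (simp add: \<alpha>(2))
      then show "m = n" using m n code_inj by (simp add: inj_on_eq_iff)
    qed
    show "\<alpha> ` carrier M = carrier M"
    proof (intro equalityI subsetI)
      fix a assume a: "a \<in> carrier M"
      obtain x where x: "x \<in> carrier regular" "\<theta> regular x = act (obj_map F regular) a u"
        using surj[OF R act_closed[OF FR a u]] by blast
      then obtain m where m: "m \<in> carrier M" "x = code m" by (auto elim: carrier_regularE)
      then have "\<alpha> m = a" using x a by (intro inj_u) (simp_all add: \<alpha>)
      with m show "a \<in> \<alpha> ` carrier M" by blast
    qed (use \<alpha>(1) in blast)
  qed
  then have iso: "\<alpha> \<in> iso M M" using mult \<alpha>(1) by (simp add: iso_def hom_def)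
  have bij: "bij_betw (\<theta> X) (carrier X) (carrier (obj_map F X))" if X: "X \<in> OB" for X
    unfolding bij_betw_def
  proof
    show "inj_on (\<theta> X) (carrier X)" using inj[OF X] by (rule inj_onI)
    show "\<theta> X ` carrier X = carrier (obj_map F X)"
    proof (intro equalityI subsetI)
      fix y assume "y \<in> carrier (obj_map F X)"
      then obtain x where "x \<in> carrier X" "\<theta> X x = y" using surj[OF X] by blast
      then show "y \<in> \<theta> X ` carrier X" by blast
    qed (use \<theta>_closed[OF X] in blast)
  qed
  show thesis by (rule that[OF iso bij twisted natural])
qed

end

context regular_action
begin

text \<open>
  At the regular action, naturality with respect to right multiplications says that the component is
  itself right-linear, so it is left multiplication by some \<open>c\<close>; equivariance of the component between
  the twisted actions is then the intertwining equation.
\<close>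

lemma naturally_isomorphic_twists:
  assumes \<alpha>: "monoid_endomorphism M \<alpha>" and \<beta>: "monoid_endomorphism M \<beta>"
    and iso: "naturally_isomorphic (action_category M U) (action_category M U) (twist_functor M \<alpha>) (twist_functor M \<beta>)"
  obtains c where "c \<in> carrier M" "\<And>m. m \<in> carrier M \<Longrightarrow> c \<otimes> \<alpha> m = \<beta> m \<otimes> c"
proof -
  interpret C: is_category "action_category M U" by (rule action_category_is_category)
  interpret \<alpha>: monoid_endomorphism M \<alpha> by (rule \<alpha>)
  obtain \<eta> where \<eta>: "natural_iso_between (action_category M U) \<eta> (twist_functor M \<alpha>) (twist_functor M \<beta>)"
    using iso unfolding naturally_isomorphic_iff by blast
  have "C.arrow (\<eta> regular) (twist_set M \<alpha> regular) (twist_set M \<beta> regular)"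
    using C.natural_iso_betweenE[OF \<eta> regular_OB] by (metis twist_functor_simps(1))
  then obtain e where e: "e \<in> equivariant_maps M (twist_set M \<alpha> regular) (twist_set M \<beta> regular)"
    and \<eta>e: "\<eta> regular = (twist_set M \<alpha> regular, e, twist_set M \<beta> regular)"
    unfolding action_category_arrow by blast
  have one: "code \<one> \<in> carrier regular" by (simp add: code_closed)
  obtain c where c: "c \<in> carrier M" "e (code \<one>) = code c"
    using equivariant_closed[OF e, of "code \<one>"] one by (auto elim: carrier_regularE)
  have right: "e (code n) = code (c \<otimes> n)" if n: "n \<in> carrier M" for n
  proof -
    let ?r = "orbit_map regular (code n)"
    have r: "?r \<in> equivariant_maps M regular regular"
      by (rule orbit_map_equivariant[OF regular_is_action_set code_closed[OF n]])
    then have "C.arrow (regular, ?r, regular) regular regular"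
      using regular_OB by (simp add: action_category_arrow)
    from C.natural_iso_between_natural[OF \<eta> this]
    have "compose (carrier regular) e ?r = compose (carrier regular) ?r e"
      by (simp add: \<eta>e action_category_Comp)
    from compose_eqD[OF this one] show ?thesis
      using n c by (simp add: orbit_map_code act_regular)
  qed
  have "c \<otimes> \<alpha> m = \<beta> m \<otimes> c" if m: "m \<in> carrier M" for m
  proof -
    have "\<beta> m \<in> carrier M" by (rule monoid_endomorphism.closed[OF \<beta> m])
    have "e (act (twist_set M \<alpha> regular) m (code \<one>)) = act (twist_set M \<beta> regular) m (e (code \<one>))"
      by (rule equivariant_act[OF e m]) (simp add: one)
    then have "code (c \<otimes> \<alpha> m) = code (\<beta> m \<otimes> c)"
      using m c \<alpha>.closed[OF m] \<open>\<beta> m \<in> carrier M\<close> by (simp add: act_regular right)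
    then show ?thesis
      using c \<alpha>.closed[OF m] \<open>\<beta> m \<in> carrier M\<close> code_inj by (simp add: inj_on_eq_iff)
  qed
  with c(1) show thesis by (rule that)
qed

end

section \<open>Automorphisms of the monoid of nonsingular matrices\<close>

definition mat2 :: "int \<Rightarrow> int \<Rightarrow> int \<Rightarrow> int \<Rightarrow> int^2^2" where
  "mat2 a b c d = vector [vector [a, b], vector [c, d]]"

lemma mat2_mult [simp]:
  "mat2 a b c d ** mat2 a' b' c' d'
    = mat2 (a * a' + b * c') (a * b' + b * d') (c * a' + d * c') (c * b' + d * d')"
  by (simp add: mat2_def matrix_matrix_mult_def vec_eq_iff forall_2 sum_2)

lemma mat2_eq_iff [simp]:
  "mat2 a b c d = mat2 a' b' c' d' \<longleftrightarrow> a = a' \<and> b = b' \<and> c = c' \<and> d = d'"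
  by (auto simp add: mat2_def vec_eq_iff forall_2)

lemma det_mat2 [simp]: "det (mat2 a b c d) = a * d - b * c"
  by (simp add: mat2_def det_2)

lemma mat_eq_mat2: "mat k = mat2 k 0 0 k"
  by (simp add: mat2_def mat_def vec_eq_iff forall_2)

lemma mat2_cases: obtains a b c d where "A = mat2 a b c d"
proof
  show "A = mat2 (A $ 1 $ 1) (A $ 1 $ 2) (A $ 2 $ 1) (A $ 2 $ 2)"
    by (simp add: mat2_def vec_eq_iff forall_2)
qed

text \<open>
  The intertwiner has nonzero determinant but need not be invertible over the integers. Its adjugate
  replaces the inverse: taking traces multiplies both sides by the determinant, which cancels.
\<close>

lemma intertwined_det_trace:
  assumes "mat2 a b c d ** mat2 x y z w = mat2 x' y' z' w' ** mat2 a b c d"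
    and "a * d - b * c \<noteq> 0"
  shows "x * w - y * z = x' * w' - y' * z'" and "x + w = x' + w'"
proof -
  have "det (mat2 a b c d ** mat2 x y z w) = det (mat2 x' y' z' w' ** mat2 a b c d)"
    using assms(1) by (rule arg_cong)
  then have "(a * d - b * c) * (x * w - y * z) = (a * d - b * c) * (x' * w' - y' * z')"
    unfolding det_mul by (simp add: mult.commute)
  then show "x * w - y * z = x' * w' - y' * z'"
    using assms(2) by simp
  have "mat2 a b c d ** mat2 x y z w ** mat2 d (- b) (- c) a
      = mat2 x' y' z' w' ** mat2 a b c d ** mat2 d (- b) (- c) a"
    using assms(1) by simp
  then have "(a * d - b * c) * (x + w) = (a * d - b * c) * (x' + w')"
    by simp algebra
  then show "x + w = x' + w'"
    using assms(2) by simp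
qed

abbreviation transvection :: "int \<Rightarrow> int^2^2" where
  "transvection t \<equiv> mat2 1 t 0 1"

locale M2ns_automorphism =
  fixes \<phi> :: "int^2^2 \<Rightarrow> int^2^2"
  assumes iso: "\<phi> \<in> iso M2ns M2ns"
begin

lemma mult: "det A \<noteq> 0 \<Longrightarrow> det B \<noteq> 0 \<Longrightarrow> \<phi> (A ** B) = \<phi> A ** \<phi> B"
  using iso by (auto simp: iso_def hom_def M2ns_def)

lemma det_nonzero: "det A \<noteq> 0 \<Longrightarrow> det (\<phi> A) \<noteq> 0"
  using iso by (auto simp: iso_def hom_def M2ns_def)

lemma inj: "\<phi> A = \<phi> B \<Longrightarrow> det A \<noteq> 0 \<Longrightarrow> det B \<noteq> 0 \<Longrightarrow> A = B"
  using iso by (auto simp: iso_def M2ns_def bij_betw_def inj_on_def)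

lemma surj:
  assumes "det B \<noteq> 0"
  obtains A where "det A \<noteq> 0" "\<phi> A = B"
  using iso assms by (force simp: iso_def M2ns_def bij_betw_def)

lemma one: "\<phi> (mat 1) = mat 1"
proof -
  obtain A where A: "det A \<noteq> 0" "\<phi> A = mat 1"
    by (rule surj[of "mat 1"]) auto
  then have "\<phi> (mat 1) = \<phi> A ** \<phi> (mat 1)" by simp
  also have "\<dots> = \<phi> A" using A(1) by (subst mult[symmetric]) simp_all
  finally show ?thesis using A by simp
qed

lemma conjugate:
  assumes "P ** Q = mat 1" "Q ** P = mat 1"
  shows "M2ns_automorphism (\<lambda>A. P ** \<phi> A ** Q)"
proof
  have nz: "det P \<noteq> 0" "det Q \<noteq> 0"
    using assms(1) det_mul[of P Q] by auto
  have QP: "Q ** (P ** A) = A" and PQ: "P ** (Q ** A) = A" for A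
    by (simp_all add: matrix_mul_assoc assms)
  note assoc = matrix_mul_assoc[symmetric]
  have "bij_betw (\<lambda>A. P ** \<phi> A ** Q) {A. det A \<noteq> 0} {A. det A \<noteq> 0}"
  proof (rule bij_betwI')
    fix A B :: "int^2^2" assume "A \<in> {A. det A \<noteq> 0}" "B \<in> {A. det A \<noteq> 0}"
    moreover have "\<phi> A = \<phi> B" if "P ** \<phi> A ** Q = P ** \<phi> B ** Q"
      using arg_cong[OF that, of "\<lambda>X. Q ** X ** P"] by (simp add: assoc QP assms)
    ultimately show "P ** \<phi> A ** Q = P ** \<phi> B ** Q \<longleftrightarrow> A = B"
      using inj by auto
  next
    fix A :: "int^2^2" assume "A \<in> {A. det A \<noteq> 0}"
    then show "P ** \<phi> A ** Q \<in> {A. det A \<noteq> 0}"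
      using nz det_nonzero by (simp add: det_mul)
  next
    fix B :: "int^2^2" assume "B \<in> {A. det A \<noteq> 0}"
    then have "det (Q ** B ** P) \<noteq> 0" using nz by (simp add: det_mul)
    then obtain A where "det A \<noteq> 0" "\<phi> A = Q ** B ** P" by (rule surj)
    then have "B = P ** \<phi> A ** Q" by (simp add: assoc PQ assms)
    with \<open>det A \<noteq> 0\<close> show "\<exists>A\<in>{A. det A \<noteq> 0}. B = P ** \<phi> A ** Q" by auto
  qed
  then show "(\<lambda>A. P ** \<phi> A ** Q) \<in> iso M2ns M2ns"
    using nz by (auto simp: iso_def hom_def M2ns_def det_mul det_nonzero mult assoc QP)
qed

text \<open>
  With \<open>X\<close> the image of the transvection, the images of \<open>diag(2, 1)\<close> and \<open>diag(3, 1)\<close> intertwine \<open>X\<close>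
  with \<open>X\<^sup>2\<close> and \<open>X\<^sup>3\<close>. The first relation gives \<open>det X = (det X)\<^sup>2\<close>, so \<open>det X = 1\<close>, and
  \<open>t = t\<^sup>2 - 2\<close> for the trace \<open>t\<close>, so \<open>t\<close> is \<open>2\<close> or \<open>-1\<close>. In the second case \<open>X\<close> would have order 3,
  and then \<open>X\<close> and \<open>X\<^sup>3\<close> would have different traces.
\<close>

lemma transvection_image_unipotent:
  assumes "\<phi> (transvection 1) = mat2 x y z w"
  shows "x * w - y * z = 1" and "x + w = 2"
proof -
  let ?X = "mat2 x y z w"
  have sim: "\<phi> (mat2 2 0 0 1) ** ?X = ?X ** ?X ** \<phi> (mat2 2 0 0 1)"
    "\<phi> (mat2 3 0 0 1) ** ?X = ?X ** ?X ** ?X ** \<phi> (mat2 3 0 0 1)"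
    using mult[of "mat2 2 0 0 1" "transvection 1"] mult[of "transvection 2" "mat2 2 0 0 1"]
      mult[of "mat2 3 0 0 1" "transvection 1"] mult[of "transvection 3" "mat2 3 0 0 1"]
      mult[of "transvection 1" "transvection 1"] mult[of "transvection 2" "transvection 1"]
    by (simp_all add: assms)
  obtain a b c d where A: "\<phi> (mat2 2 0 0 1) = mat2 a b c d" by (rule mat2_cases)
  obtain a' b' c' d' where B: "\<phi> (mat2 3 0 0 1) = mat2 a' b' c' d'" by (rule mat2_cases)
  have nz: "a * d - b * c \<noteq> 0" "a' * d' - b' * c' \<noteq> 0" "x * w - y * z \<noteq> 0"
    using det_nonzero[of "mat2 2 0 0 1"] det_nonzero[of "mat2 3 0 0 1"]
      det_nonzero[of "transvection 1"] A B assms by simp_all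
  obtain x2 y2 z2 w2 where X2: "?X ** ?X = mat2 x2 y2 z2 w2" by (rule mat2_cases)
  obtain x3 y3 z3 w3 where X3: "mat2 x2 y2 z2 w2 ** ?X = mat2 x3 y3 z3 w3" by (rule mat2_cases)
  note two = intertwined_det_trace[OF sim(1)[unfolded A X2] nz(1)]
  note three = intertwined_det_trace[OF sim(2)[unfolded B X2 X3] nz(2)]
  have "(x * w - y * z) * (x * w - y * z) = (x * w - y * z) * 1"
    using two(1) X2 by simp algebra
  then show det: "x * w - y * z = 1" using nz(3) by simp
  have "x + w = (x + w)^2 - 2 * (x * w - y * z)"
    using two(2) X2 by simp algebra
  then have "(x + w - 2) * (x + w + 1) = 0" using det by algebra
  then consider "x + w = 2" | "x + w = -1" by (auto simp: eq_neg_iff_add_eq_0)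
  then show "x + w = 2"
  proof cases
    case 2
    have "x + w = (x + w)^3 - 3 * (x * w - y * z) * (x + w)"
      using three(2) X2 X3 by simp algebra
    then show ?thesis using 2 det by simp
  qed
qed


lemma transvection_image_transvection:
  assumes "\<phi> (transvection 1) = transvection k"
  shows "\<phi> (transvection j) = transvection (k * j)"
proof (induction j rule: int_induct[where k = 0])
  case base
  show ?case using one by (simp add: mat_eq_mat2)
next
  case (step1 i)
  then show ?case
    using mult[of "transvection i" "transvection 1"] assms by (simp add: algebra_simps)
next
  case (step2 i)
  obtain a b c d where "\<phi> (transvection (i - 1)) = mat2 a b c d" by (rule mat2_cases)
  then show ?case
    using step2 mult[of "transvection (i - 1)" "transvection 1"] assms by (auto simp: algebra_simps)
qed

text \<open>
  The preimage \<open>Z\<close> of the transvection by \<open>1\<close> commutes with it, because its image commutes with the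
  transvection by \<open>k\<close>. So \<open>Z\<close> is a sign times a transvection, and \<open>k\<close> divides \<open>1\<close>. The square of \<open>Z\<close>
  is considered because it does not see the sign.
\<close>

lemma transvection_multiplier:
  assumes E: "\<phi> (transvection 1) = transvection k"
  shows "\<bar>k\<bar> = 1"
proof -
  obtain Z where Z: "det Z \<noteq> 0" "\<phi> Z = transvection 1"
    by (rule surj[of "transvection 1"]) auto
  obtain Z' where Z': "det Z' \<noteq> 0" "\<phi> Z' = transvection (-1)"
    by (rule surj[of "transvection (-1)"]) auto
  have "\<phi> (Z ** transvection 1) = \<phi> (transvection 1 ** Z)"
    using Z by (simp add: mult E)
  then have comm: "Z ** transvection 1 = transvection 1 ** Z"
    by (rule inj) (use Z in \<open>simp_all add: det_mul\<close>)
  have "\<phi> (Z ** Z') = \<phi> (mat 1)"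
    using Z Z' by (simp add: mult one) (simp add: mat_eq_mat2)
  then have "Z ** Z' = mat 1"
    by (rule inj) (use Z Z' in \<open>simp_all add: det_mul\<close>)
  then have "det Z * det Z' = 1"
    by (metis det_I det_mul)
  then have unit: "\<bar>det Z\<bar> = 1"
    by (metis abs_zmult_eq_1 abs_one)
  obtain a b c d where abcd: "Z = mat2 a b c d" by (rule mat2_cases)
  with comm have "c = 0" "d = a" by simp_all
  with unit abcd have "a * a = 1" by (simp add: abs_mult)
  then have "Z ** Z = transvection (2 * a * b)"
    by (simp add: abcd \<open>c = 0\<close> \<open>d = a\<close>)
  then have "transvection 2 = \<phi> (transvection (2 * a * b))"
    using mult[of Z Z] Z by simp
  then have "k * (a * b) = 1"
    by (simp add: transvection_image_transvection[OF E])
  then show ?thesis by (metis abs_zmult_eq_1 abs_one)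
qed

end

text \<open>
  The first column of \<open>Q\<close> is a primitive fixed vector of the matrix, completed to a unimodular matrix
  with Bezout coefficients. Here \<open>(x - 1, z)\<close> is fixed by the Cayley-Hamilton relation and becomes
  primitive after division by the gcd. In the new basis the first column is that of the identity, and
  then the trace determines the other diagonal entry.
\<close>

lemma unipotent_conjugate_transvection:
  assumes det: "x * w - y * z = 1" and tr: "x + w = 2"
  obtains P Q k where "P ** Q = mat 1" "Q ** P = mat 1" "P ** mat2 x y z w ** Q = transvection k"
proof (cases "z = 0")
  case True
  have "(x - 1)\<^sup>2 = 0" using assms True by algebra
  then have "x = 1" by simp
  with tr have "w = 1" by simp
  with \<open>x = 1\<close> True that[of "mat 1" "mat 1" y] show thesis by simp
next
  case False
  define g where "g = gcd (x - 1) z"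
  have "g \<noteq> 0" using False by (simp add: g_def)
  obtain p r where pr: "x - 1 = g * p" "z = g * r"
    unfolding g_def by (metis dvdE gcd_dvd1 gcd_dvd2)
  obtain s' u where "s' * z + u * (x - 1) = g"
    unfolding g_def by (metis bezout_int gcd.commute)
  then have "g * (p * u + r * s') = g * 1"
    unfolding pr by (simp add: algebra_simps)
  then have bezout: "p * u + r * s' = 1" using \<open>g \<noteq> 0\<close> by simp
  have "g * (x * p + y * r) = g * p" "g * (z * p + w * r) = g * r"
    using pr det tr by algebra+
  then have fixed: "x * p + y * r = p" "z * p + w * r = r"
    using \<open>g \<noteq> 0\<close> by simp_all
  let ?Q = "mat2 p (- s') r u" and ?P = "mat2 u s' (- r) p"
  have "?P ** ?Q = mat 1" "?Q ** ?P = mat 1"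
    using bezout by (simp_all add: mat_eq_mat2 algebra_simps)
  moreover have "?P ** mat2 x y z w ** ?Q
      = transvection ((u * x + s' * z) * (- s') + (u * y + s' * w) * u)"
    using bezout fixed tr by simp algebra
  ultimately show thesis by (rule that)
qed

lemma (in M2ns_automorphism) conjugate_fixes_transvection:
  obtains P Q where "P ** Q = mat 1" "Q ** P = mat 1"
    "P ** \<phi> (transvection 1) ** Q = transvection 1"
proof -
  obtain x y z w where X: "\<phi> (transvection 1) = mat2 x y z w" by (rule mat2_cases)
  obtain P Q k where PQ: "P ** Q = mat 1" "Q ** P = mat 1" "P ** \<phi> (transvection 1) ** Q = transvection k"
    unfolding X using unipotent_conjugate_transvection[OF transvection_image_unipotent[OF X]] .
  interpret conj: M2ns_automorphism "\<lambda>A. P ** \<phi> A ** Q"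
    by (rule conjugate[OF PQ(1,2)])
  have "\<bar>k\<bar> = 1" by (rule conj.transvection_multiplier[OF PQ(3)])
  \<comment> \<open>Conjugation by \<open>diag(-1, 1)\<close> exchanges the transvections by \<open>1\<close> and \<open>-1\<close>.\<close>
  let ?K = "mat2 k 0 0 1"
  have K: "?K ** ?K = mat 1" "?K ** transvection k ** ?K = transvection 1"
    using \<open>\<bar>k\<bar> = 1\<close> by (auto simp: mat_eq_mat2 abs_if split: if_splits)
  show thesis
  proof
    show "(?K ** P) ** (Q ** ?K) = mat 1" "(Q ** ?K) ** (?K ** P) = mat 1"
      using PQ K(1) matrix_mul_assoc[of P Q ?K] matrix_mul_assoc[of ?K ?K P]
      by (simp_all add: matrix_mul_assoc[symmetric] del: mat2_mult)
    have "(?K ** P) ** \<phi> (transvection 1) ** (Q ** ?K) = ?K ** (P ** \<phi> (transvection 1) ** Q) ** ?K"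
      by (simp add: matrix_mul_assoc del: mat2_mult)
    then show "(?K ** P) ** \<phi> (transvection 1) ** (Q ** ?K) = transvection 1"
      using PQ(3) K(2) by simp
  qed
qed

lemma mat_mult_mult:
  fixes A B :: "int^2^2"
  shows "mat (k * l) ** (A ** B) = mat k ** A ** (mat l ** B)"
  by (rule mat2_cases[of A], rule mat2_cases[of B]) (simp add: mat_eq_mat2 algebra_simps)

lemma abs_det_eq_one_if_right_inverse:
  fixes A B :: "int^2^2"
  assumes "A ** B = mat 1" 
  shows "\<bar>det A\<bar> = 1"
proof -
  have "det A * det B = 1" using assms by (metis det_I det_mul)
  then show ?thesis by (metis abs_zmult_eq_1 abs_one)
qed

lemma right_inverse_if_abs_det_eq_one:
  fixes A :: "int^2^2"
  assumes "\<bar>det A\<bar> = 1"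
  obtains B where "A ** B = mat 1"
proof -
  obtain a b c d where A: "A = mat2 a b c d" by (rule mat2_cases)
  have "(a * d - b * c) * (a * d - b * c) = 1"
    using assms unfolding A by (metis abs_mult_self_eq det_mat2 mult_1)
  then show thesis
    using that[of "mat (det A) ** mat2 d (- b) (- c) a"]
    by (simp add: A mat_eq_mat2 algebra_simps)
qed

locale M2ns_automorphism_fixing_transvection = M2ns_automorphism +
  assumes fixes_transvection: "\<phi> (transvection 1) = transvection 1"
begin

lemma det_image_unit:
  assumes "\<bar>det A\<bar> = 1"
  shows "\<bar>det (\<phi> A)\<bar> = 1"
proof -
  obtain B where B: "A ** B = mat 1" using assms by (rule right_inverse_if_abs_det_eq_one)
  then have "det A \<noteq> 0 \<and> det B \<noteq> 0"
    by (metis det_I det_mul mult_not_zero zero_neq_one)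
  then have "\<phi> A ** \<phi> B = mat 1" using B one by (simp add: mult[symmetric])
  then show ?thesis by (rule abs_det_eq_one_if_right_inverse)
qed

text \<open>
  The equation \<open>diag(n, 1) T = T\<^sup>n diag(n, 1)\<close> for the transvection \<open>T\<close> by \<open>1\<close>, which \<open>\<phi>\<close> preserves, puts
  the image of \<open>diag(n, 1)\<close> in this shape.
\<close>

lemma image_dilation:
  assumes "n \<noteq> 0"
  obtains b d where "\<phi> (mat2 n 0 0 1) = mat2 (n * d) b 0 d"
proof -
  obtain a b c d where Y: "\<phi> (mat2 n 0 0 1) = mat2 a b c d" by (rule mat2_cases)
  have "mat2 a b c d ** transvection 1 = transvection n ** mat2 a b c d"
    using mult[of "mat2 n 0 0 1" "transvection 1"] mult[of "transvection n" "mat2 n 0 0 1"]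
      assms transvection_image_transvection[of 1 n]
    by (simp add: fixes_transvection Y)
  then have "a = n * d" "c = 0" using assms by auto
  then show thesis using Y that by simp
qed

text \<open>
  A matrix of prime determinant is irreducible, so its image is too. An upper triangular matrix is a
  product of two matrices whose determinants are its diagonal entries, so one of these entries is a
  unit; here this can only be the lower one.
\<close>

lemma image_double:
  obtains b d where "\<phi> (mat2 2 0 0 1) = mat2 (2 * d) b 0 d" "\<bar>d\<bar> = 1"
proof -
  obtain b d where Y: "\<phi> (mat2 2 0 0 1) = mat2 (2 * d) b 0 d" by (rule image_dilation) auto
  have "d \<noteq> 0" using det_nonzero[of "mat2 2 0 0 1"] Y by simp
  obtain A where A: "det A \<noteq> 0" "\<phi> A = mat2 1 b 0 d"
    by (rule surj[of "mat2 1 b 0 d"]) (use \<open>d \<noteq> 0\<close> in auto)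
  obtain B where B: "det B \<noteq> 0" "\<phi> B = mat2 (2 * d) 0 0 1"
    by (rule surj[of "mat2 (2 * d) 0 0 1"]) (use \<open>d \<noteq> 0\<close> in auto)
  have "\<phi> (A ** B) = \<phi> (mat2 2 0 0 1)" using A B Y by (simp add: mult)
  then have "A ** B = mat2 2 0 0 1" by (rule inj) (use A B in \<open>simp_all add: det_mul\<close>)
  then have "det A * det B = 2" by (metis det_mat2 det_mul diff_zero mult.right_neutral mult_zero_left)
  then have "nat \<bar>det A\<bar> * nat \<bar>det B\<bar> = 2" by (simp add: nat_mult_distrib[symmetric] abs_mult[symmetric])
  then have "nat \<bar>det A\<bar> = 1 \<or> nat \<bar>det B\<bar> = 1"
    using two_is_prime_nat by (metis prime_product)
  then have "\<bar>det (\<phi> A)\<bar> = 1 \<or> \<bar>det (\<phi> B)\<bar> = 1"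
    by (auto intro: det_image_unit)
  then have "\<bar>d\<bar> = 1" using A B by (auto simp: abs_mult)
  with Y that show thesis by blast
qed

text \<open>
  The image of the reflection is a sign times an upper triangular matrix with upper right entry \<open>\<beta>\<close>
  and diagonal entries \<open>-1\<close> and \<open>1\<close>. Conjugation by transvections changes \<open>\<beta>\<close> only by even numbers.
  That \<open>\<beta>\<close> is even follows from commuting with the image of \<open>diag(2, 1)\<close>, where \<open>d\<close> is odd.
\<close>

lemma conjugate_diagonalises_reflection:
  obtains t \<delta> where "\<bar>\<delta>\<bar> = 1"
    "transvection t ** \<phi> (mat2 (-1) 0 0 1) ** transvection (- t) = mat2 (- \<delta>) 0 0 \<delta>"
proof -
  obtain \<beta> \<delta> where S: "\<phi> (mat2 (-1) 0 0 1) = mat2 (- \<delta>) \<beta> 0 \<delta>"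
    by (rule image_dilation[of "-1"]) auto
  have unit: "\<bar>\<delta>\<bar> = 1" using det_image_unit[of "mat2 (-1) 0 0 1"] S
    by (simp add: abs_mult) (metis abs_one abs_zmult_eq_1)
  obtain b d where Y: "\<phi> (mat2 2 0 0 1) = mat2 (2 * d) b 0 d" "\<bar>d\<bar> = 1" by (rule image_double)
  have "\<phi> (mat2 (-1) 0 0 1) ** \<phi> (mat2 2 0 0 1) = \<phi> (mat2 2 0 0 1) ** \<phi> (mat2 (-1) 0 0 1)"
    by (simp add: mult[symmetric])
  then have "d * \<beta> = - 2 * (b * \<delta>)" by (simp add: S Y algebra_simps)
  then have "even \<beta>" using \<open>\<bar>d\<bar> = 1\<close> by (auto simp: abs_if split: if_splits)
  then obtain \<gamma> where "\<beta> = 2 * \<gamma>" by blast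
  then show thesis
    using that[of \<delta> "- \<delta> * \<gamma>"] unit by (auto simp: S abs_if split: if_splits)
qed

end

text \<open>
  These two conditions pin down the automorphism up to a sign depending on the determinant. The sign \<open>\<delta>\<close>
  cannot be removed by conjugation.
\<close>

locale M2ns_automorphism_normalised = M2ns_automorphism_fixing_transvection +
  fixes \<delta> :: int
  assumes \<delta>_unit: "\<bar>\<delta>\<bar> = 1"
    and image_reflection: "\<phi> (mat2 (-1) 0 0 1) = mat2 (- \<delta>) 0 0 \<delta>"
begin

text \<open>
  A preimage of a scalar matrix commutes with a transvection and with the reflection, and the only
  matrices that commute with both are scalar.
\<close>

lemma preimage_scalar:
  assumes "k \<noteq> 0"
  obtains l where "l \<noteq> 0" "\<phi> (mat l) = mat k"
proof -
  obtain K where K: "det K \<noteq> 0" "\<phi> K = mat k"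
    by (rule surj[of "mat k"]) (use assms in \<open>auto simp: mat_eq_mat2\<close>)
  have "\<phi> (K ** transvection 1) = \<phi> (transvection 1 ** K)"
    using K by (simp add: mult fixes_transvection mat_eq_mat2)
  then have 1: "K ** transvection 1 = transvection 1 ** K"
    by (rule inj) (use K in \<open>simp_all add: det_mul\<close>)
  have "\<phi> (K ** mat2 (-1) 0 0 1) = \<phi> (mat2 (-1) 0 0 1 ** K)"
    using K by (simp add: mult image_reflection mat_eq_mat2)
  then have 2: "K ** mat2 (-1) 0 0 1 = mat2 (-1) 0 0 1 ** K"
    by (rule inj) (use K in \<open>simp_all add: det_mul\<close>)
  obtain a b c d where "K = mat2 a b c d" by (rule mat2_cases)
  with 1 2 have "K = mat a" by (auto simp: mat_eq_mat2)
  with K that[of a] show thesis by (auto simp: mat_eq_mat2)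
qed

lemma image_minus_one: "\<phi> (mat (-1)) = mat (-1)"
proof -
  obtain l where l: "l \<noteq> 0" "\<phi> (mat l) = mat (-1)" by (rule preimage_scalar[of "-1"]) auto
  let ?L = "mat l :: int^2^2"
  have "\<phi> (?L ** ?L) = \<phi> (mat 1)"
    using l one mult[of ?L ?L] by (simp add: mat_eq_mat2)
  then have "?L ** ?L = mat 1" by (rule inj) (use l in \<open>simp_all add: mat_eq_mat2\<close>)
  then have "l * l = 1" by (simp add: mat_eq_mat2)
  then have "l = 1 \<or> l = -1" by (simp add: square_eq_1_iff)
  moreover have "l \<noteq> 1" using l one by (auto simp: mat_eq_mat2)
  ultimately show ?thesis using l by simp
qed

text \<open>
  The image of \<open>diag(n, 1)\<close> is a scalar times that matrix, and its lower right entry is the scalar.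
\<close>

definition dilation_sign :: "int \<Rightarrow> int" where
  "dilation_sign n = \<phi> (mat2 n 0 0 1) $ 2 $ 2"

text \<open>
  The image commutes with that of the reflection, so it is \<open>d\<close> times \<open>D = diag(n, 1)\<close>. With preimages
  \<open>l\<close> of the scalar \<open>d\<close> and \<open>Y\<close> of \<open>D\<close>, both \<open>l Y\<close> and \<open>D\<close> have the image \<open>d D\<close>, so \<open>l Y = D\<close>. As \<open>D\<close> has
  an entry \<open>1\<close>, \<open>l\<close> is a sign, and hence so is \<open>d\<close>.
\<close>

lemma dilation:
  assumes "n \<noteq> 0"
  shows "\<phi> (mat2 n 0 0 1) = mat (dilation_sign n) ** mat2 n 0 0 1"
    and "\<bar>dilation_sign n\<bar> = 1"
proof -
  obtain b d where Y: "\<phi> (mat2 n 0 0 1) = mat2 (n * d) b 0 d" using assms by (rule image_dilation)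
  have d: "dilation_sign n = d" by (simp add: dilation_sign_def Y) (simp add: mat2_def)
  have "\<phi> (mat2 n 0 0 1) ** \<phi> (mat2 (-1) 0 0 1) = \<phi> (mat2 (-1) 0 0 1) ** \<phi> (mat2 n 0 0 1)"
    using assms by (simp add: mult[symmetric])
  then have "b = 0" using \<delta>_unit by (auto simp: Y image_reflection abs_if split: if_splits)
  with Y show image: "\<phi> (mat2 n 0 0 1) = mat (dilation_sign n) ** mat2 n 0 0 1"
    by (simp add: mat_eq_mat2 d)
  have "d \<noteq> 0" using det_nonzero[of "mat2 n 0 0 1"] assms Y by simp
  then obtain l where l: "l \<noteq> 0" "\<phi> (mat l) = mat d" by (rule preimage_scalar)
  obtain Y where Y: "det Y \<noteq> 0" "\<phi> Y = mat2 n 0 0 1"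
    by (rule surj[of "mat2 n 0 0 1"]) (use assms in auto)
  have "\<phi> (mat l ** Y) = \<phi> (mat2 n 0 0 1)"
    using l Y image by (subst mult) (simp_all add: mat_eq_mat2 d)
  then have "mat l ** Y = mat2 n 0 0 1"
    by (rule inj) (use l Y assms in \<open>simp_all add: det_mul mat_eq_mat2\<close>)
  moreover obtain a' b' c' d' where "Y = mat2 a' b' c' d'" by (rule mat2_cases)
  ultimately have "l * d' = 1" by (simp add: mat_eq_mat2)
  then have "\<bar>l\<bar> = 1" by (metis abs_zmult_eq_1 abs_one)
  then have "l = 1 \<or> l = -1" by linarith
  then have "mat d = (mat 1 :: int^2^2) \<or> mat d = (mat (-1) :: int^2^2)" using l one image_minus_one by auto
  then show "\<bar>dilation_sign n\<bar> = 1" by (auto simp: d mat_eq_mat2)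
qed

lemma dilation_sign_mult:
  assumes "m \<noteq> 0" "n \<noteq> 0"
  shows "dilation_sign (m * n) = dilation_sign m * dilation_sign n"
proof -
  have "\<phi> (mat2 (m * n) 0 0 1) = \<phi> (mat2 m 0 0 1) ** \<phi> (mat2 n 0 0 1)"
    using assms by (simp add: mult[symmetric])
  then show ?thesis using assms dilation(1)[of "m * n"] dilation(1)[of m] dilation(1)[of n]
    by (simp add: mat_eq_mat2)
qed

abbreviation swap :: "int^2^2" where "swap \<equiv> mat2 0 1 1 0"

text \<open>
  Exchanging the coordinates anticommutes with the reflection and squares to the identity, so its image
  is a sign times itself. That this sign is the one of the reflection \<open>S\<close>, which also has determinant
  \<open>-1\<close>, follows from the element \<open>J = S W T\<close> with the exchange \<open>W\<close> and the transvection \<open>T\<close>: it satisfies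
  \<open>J\<^sup>3 = -1\<close>, so the image of \<open>J\<close> is \<open>J\<close> times a cube root of \<open>1\<close>.
\<close>

lemma image_swap: "\<phi> swap = mat (dilation_sign (-1)) ** swap"
proof -
  let ?S = "mat2 (-1) 0 0 1" and ?s = "dilation_sign (-1)"
  have S: "\<phi> ?S = mat ?s ** ?S" "\<bar>?s\<bar> = 1"
    using dilation[of "-1"] by auto
  have nz: "?s \<noteq> 0" using S by auto
  obtain a b c d where W: "\<phi> swap = mat2 a b c d" by (rule mat2_cases)
  have "\<phi> swap ** \<phi> ?S = \<phi> (mat (-1) ** ?S ** swap)"
    using mult[of swap ?S] by (simp add: mat_eq_mat2)
  also have "\<dots> = mat (-1) ** \<phi> ?S ** \<phi> swap"
    using mult[of "mat (-1)" ?S] mult[of "mat (-1) ** ?S" swap] image_minus_one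
    by (simp add: mat_eq_mat2)
  finally have "a = 0" "d = 0"
    using nz by (auto simp: W S mat_eq_mat2)
  moreover have "\<phi> swap ** \<phi> swap = mat 1"
    using mult[of swap swap] one by (simp add: mat_eq_mat2)
  ultimately have "b * c = 1" by (simp add: W mat_eq_mat2)
  then have "\<bar>c\<bar> = 1" by (metis abs_zmult_eq_1 abs_one mult.commute)
  then have "b = c" using \<open>b * c = 1\<close> by (auto simp: abs_if split: if_splits)
  define \<epsilon> where "\<epsilon> = ?s * c"
  have "\<bar>\<epsilon>\<bar> = 1" using \<open>\<bar>c\<bar> = 1\<close> S by (simp add: \<epsilon>_def abs_mult)
  let ?J = "?S ** swap ** transvection 1"
  have "\<phi> ?J = mat \<epsilon> ** ?J"
    using mult[of ?S swap] mult[of "?S ** swap" "transvection 1"]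
    by (simp add: S W \<open>a = 0\<close> \<open>d = 0\<close> \<open>b = c\<close> fixes_transvection mat_eq_mat2 \<epsilon>_def)
  then have "\<phi> (?J ** ?J ** ?J) = mat \<epsilon> ** ?J ** (mat \<epsilon> ** ?J) ** (mat \<epsilon> ** ?J)"
    using mult[of ?J ?J] mult[of "?J ** ?J" ?J] by simp
  then have "\<epsilon> * \<epsilon> * \<epsilon> = 1"
    using image_minus_one by (simp add: mat_eq_mat2)
  then have "\<epsilon> = 1" using \<open>\<bar>\<epsilon>\<bar> = 1\<close> by (auto simp: abs_if split: if_splits)
  then have "c = ?s" using S \<open>\<bar>c\<bar> = 1\<close> by (auto simp: \<epsilon>_def abs_if split: if_splits)
  then show ?thesis by (simp add: W \<open>a = 0\<close> \<open>d = 0\<close> \<open>b = c\<close> mat_eq_mat2)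
qed

definition acts_by_sign :: "int^2^2 \<Rightarrow> bool" where
  "acts_by_sign A \<longleftrightarrow> \<phi> A = mat (dilation_sign (det A)) ** A"

lemma acts_by_sign_mult:
  assumes "acts_by_sign A" "acts_by_sign B" "det A \<noteq> 0" "det B \<noteq> 0"
  shows "acts_by_sign (A ** B)"
  using assms by (simp add: acts_by_sign_def mult det_mul dilation_sign_mult mat_mult_mult)

text \<open>
  The factorisation uses \<open>diag(1, d)\<close>, the conjugate of \<open>diag(d, 1)\<close> under the exchange of coordinates,
  then a transvection and \<open>diag(a, 1)\<close>.
\<close>

lemma acts_by_sign_upper_triangular:
  assumes "a \<noteq> 0" "d \<noteq> 0"
  shows "acts_by_sign (mat2 a b 0 d)"
proof -
  have sign_one: "dilation_sign 1 = 1"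
    using dilation_sign_mult[of 1 1] dilation(2)[of 1] by auto
  have dil: "acts_by_sign (mat2 n 0 0 1)" if "n \<noteq> 0" for n
    using dilation(1)[OF that] by (simp add: acts_by_sign_def)
  have trans: "acts_by_sign (transvection b)"
    using transvection_image_transvection[of 1 b] fixes_transvection
    by (simp add: acts_by_sign_def sign_one)
  have swap: "acts_by_sign swap"
    using image_swap by (simp add: acts_by_sign_def)
  have "acts_by_sign (swap ** mat2 d 0 0 1 ** swap ** transvection b ** mat2 a 0 0 1)"
    by (intro acts_by_sign_mult swap trans dil) (use assms in simp_all)
  then show ?thesis by simp
qed

text \<open>
  Row operations of the Euclidean algorithm on the first column reduce every matrix to upper triangular
  form.
\<close>

lemma acts_by_sign: 
  assumes "det A \<noteq> 0"
  shows "acts_by_sign A"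
proof -
  have "acts_by_sign (mat2 a b c d)" if "a * d - b * c \<noteq> 0" for a b c d
    using that
  proof (induction "nat \<bar>c\<bar>" arbitrary: a b c d rule: less_induct)
    case less
    show ?case
    proof (cases "c = 0")
      case True
      with less.prems show ?thesis by (auto intro: acts_by_sign_upper_triangular)
    next
      case False
      let ?q = "a div c"
      have swap: "acts_by_sign swap"
        using image_swap by (simp add: acts_by_sign_def)
      have "nat \<bar>a mod c\<bar> < nat \<bar>c\<bar>" using False by (simp add: abs_mod_less)
      moreover have "c * (b - ?q * d) - d * (a mod c) \<noteq> 0"
        using less.prems by (simp add: minus_div_mult_eq_mod[symmetric] algebra_simps)
      ultimately have "acts_by_sign (mat2 c d (a mod c) (b - ?q * d))"
        by (rule less.hyps)
      then have "acts_by_sign (transvection ?q ** swap ** mat2 c d (a mod c) (b - ?q * d))"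
        by (intro acts_by_sign_mult swap acts_by_sign_upper_triangular)
          (use \<open>c * (b - ?q * d) - d * (a mod c) \<noteq> 0\<close> in simp_all)
      then show ?thesis by (simp add: algebra_simps)
    qed
  qed
  with assms show ?thesis by (metis det_mat2 mat2_cases)
qed

end

text \<open>
  The matrix \<open>P\<close> is first chosen so that the conjugated automorphism fixes a transvection, and then
  multiplied by a transvection so that it also preserves the reflection up to sign. The formula is stated
  with \<open>P\<close> on both sides, the form in which it acts on an \<open>M\<close>-set.
\<close>

theorem M2ns_automorphism_sign_conjugation:
  assumes "\<phi> \<in> iso M2ns M2ns"
  obtains P Q \<epsilon> where "P ** Q = mat 1" "Q ** P = mat 1"
    "\<And>n. n \<noteq> 0 \<Longrightarrow> \<bar>\<epsilon> n :: int\<bar> = 1"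
    "\<And>m n. m \<noteq> 0 \<Longrightarrow> n \<noteq> 0 \<Longrightarrow> \<epsilon> (m * n) = \<epsilon> m * \<epsilon> n"
    "\<And>A. det A \<noteq> 0 \<Longrightarrow> P ** \<phi> A = mat (\<epsilon> (det A)) ** A ** P"
proof -
  interpret M2ns_automorphism \<phi> by standard (rule assms)
  obtain P Q where PQ: "P ** Q = mat 1" "Q ** P = mat 1"
    and E: "P ** \<phi> (transvection 1) ** Q = transvection 1"
    by (rule conjugate_fixes_transvection)
  interpret \<phi>1: M2ns_automorphism_fixing_transvection "\<lambda>A. P ** \<phi> A ** Q"
    using conjugate[OF PQ] E
    by (simp add: M2ns_automorphism_fixing_transvection_def M2ns_automorphism_fixing_transvection_axioms_def)
  obtain t \<delta> where \<delta>: "\<bar>\<delta>\<bar> = 1"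
    and S: "transvection t ** (P ** \<phi> (mat2 (-1) 0 0 1) ** Q) ** transvection (- t) = mat2 (- \<delta>) 0 0 \<delta>"
    by (rule \<phi>1.conjugate_diagonalises_reflection)
  let ?P = "transvection t ** P" and ?Q = "Q ** transvection (- t)"
  have T: "transvection t ** transvection (- t) = mat 1" "transvection (- t) ** transvection t = mat 1"
    by (simp_all add: mat_eq_mat2)
  note assoc = matrix_mul_assoc[symmetric]
  have "P ** (Q ** X) = X" "transvection (- t) ** (transvection t ** X) = X" for X :: "int^2^2"
    using PQ T by (simp_all add: matrix_mul_assoc del: mat2_mult)
  then have PQ': "?P ** ?Q = mat 1" "?Q ** ?P = mat 1"
    using PQ T by (simp_all add: assoc del: mat2_mult)
  have "transvection t ** transvection 1 ** transvection (- t) = transvection 1"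
    by simp
  then have E': "transvection t ** (P ** \<phi> (transvection 1) ** Q) ** transvection (- t) = transvection 1"
    unfolding E .
  interpret \<phi>2: M2ns_automorphism_normalised "\<lambda>A. ?P ** \<phi> A ** ?Q" \<delta>
    using conjugate[OF PQ'] S \<delta> E'
    by (simp add: M2ns_automorphism_normalised_def M2ns_automorphism_normalised_axioms_def
        M2ns_automorphism_fixing_transvection_def M2ns_automorphism_fixing_transvection_axioms_def
        matrix_mul_assoc del: mat2_mult)
  show thesis
  proof (rule that[OF PQ'])
    show "\<bar>\<phi>2.dilation_sign n\<bar> = 1" if "n \<noteq> 0" for n
      using that by (rule \<phi>2.dilation(2))
    show "\<phi>2.dilation_sign (m * n) = \<phi>2.dilation_sign m * \<phi>2.dilation_sign n"
      if "m \<noteq> 0" "n \<noteq> 0" for m n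
      using that by (rule \<phi>2.dilation_sign_mult)
    show "?P ** \<phi> A = mat (\<phi>2.dilation_sign (det A)) ** A ** ?P" if "det A \<noteq> 0" for A
    proof -
      have "?P ** \<phi> A ** ?Q ** ?P = mat (\<phi>2.dilation_sign (det A)) ** A ** ?P"
        using \<phi>2.acts_by_sign[OF that] by (simp add: \<phi>2.acts_by_sign_def)
      moreover have "?P ** \<phi> A ** ?Q ** ?P = ?P ** \<phi> A ** (?Q ** ?P)"
        by (rule matrix_mul_assoc[symmetric])
      ultimately show ?thesis by (simp only: PQ'(2) matrix_mul_rid)
    qed
  qed
qed

section \<open>Sign characters and sign twists\<close>

text \<open>
  The value at \<open>0\<close> is \<open>undefined\<close> because characters are extensional functions on the nonzero
  rationals.
\<close>

lemma sign_character_iff: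
  "\<kappa> \<in> carrier sign_character_group \<longleftrightarrow>
    (\<forall>q. q \<noteq> 0 \<longrightarrow> \<bar>\<kappa> q\<bar> = 1) \<and> (\<forall>p q. p \<noteq> 0 \<longrightarrow> q \<noteq> 0 \<longrightarrow> \<kappa> (p * q) = \<kappa> p * \<kappa> q)
    \<and> \<kappa> 0 = undefined"
  by (auto simp: sign_character_group_def hom_def rat_units_def sign_group_def extensional_def
      Pi_iff abs_if split: if_splits)

lemma sign_character_one: "\<kappa> \<in> carrier sign_character_group \<Longrightarrow> \<kappa> 1 = 1"
  by (metis abs_0 mult.right_neutral mult_cancel_left1 sign_character_iff zero_neq_one)

lemma sign_character_group_simps [simp]:
  "q \<noteq> 0 \<Longrightarrow> (\<kappa> \<otimes>\<^bsub>sign_character_group\<^esub> \<psi>) q = \<kappa> q * \<psi> q"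
  "q \<noteq> 0 \<Longrightarrow> \<one>\<^bsub>sign_character_group\<^esub> q = 1"
  by (simp_all add: sign_character_group_def rat_units_def sign_group_def)

lemma group_sign_character_group: "group sign_character_group"
proof (rule groupI)
  fix \<kappa> \<psi> \<xi>
  assume \<kappa>: "\<kappa> \<in> carrier sign_character_group" and \<psi>: "\<psi> \<in> carrier sign_character_group"
    and \<xi>: "\<xi> \<in> carrier sign_character_group"
  show "\<kappa> \<otimes>\<^bsub>sign_character_group\<^esub> \<psi> \<in> carrier sign_character_group"
    using \<kappa> \<psi> unfolding sign_character_iff
    by (auto simp: abs_mult algebra_simps) (simp add: sign_character_group_def rat_units_def)
  show "\<kappa> \<otimes>\<^bsub>sign_character_group\<^esub> \<psi> \<otimes>\<^bsub>sign_character_group\<^esub> \<xi>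
      = \<kappa> \<otimes>\<^bsub>sign_character_group\<^esub> (\<psi> \<otimes>\<^bsub>sign_character_group\<^esub> \<xi>)"
    by (auto simp: sign_character_group_def rat_units_def sign_group_def mult.assoc)
next
  show "\<one>\<^bsub>sign_character_group\<^esub> \<in> carrier sign_character_group"
    unfolding sign_character_iff by (auto simp: sign_character_group_def rat_units_def sign_group_def)
next
  fix \<kappa> assume \<kappa>: "\<kappa> \<in> carrier sign_character_group"
  show "\<one>\<^bsub>sign_character_group\<^esub> \<otimes>\<^bsub>sign_character_group\<^esub> \<kappa> = \<kappa>"
    using \<kappa> by (auto simp: fun_eq_iff sign_character_group_def rat_units_def sign_group_def extensional_def)
  have "\<kappa> q * \<kappa> q = 1" if "q \<noteq> 0" for q
    using \<kappa> that by (metis abs_mult_self_eq mult_1 sign_character_iff)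
  then have "\<kappa> \<otimes>\<^bsub>sign_character_group\<^esub> \<kappa> = \<one>\<^bsub>sign_character_group\<^esub>"
    by (auto simp: sign_character_group_def rat_units_def sign_group_def)
  with \<kappa> show "\<exists>\<psi>\<in>carrier sign_character_group. \<psi> \<otimes>\<^bsub>sign_character_group\<^esub> \<kappa> = \<one>\<^bsub>sign_character_group\<^esub>"
    by blast
qed

text \<open>
  An integer in the class of \<open>q\<close> modulo squares; sign characters are constant on these classes.
\<close>

definition square_class_rep :: "rat \<Rightarrow> int" where
  "square_class_rep q = fst (quotient_of q) * snd (quotient_of q)"

lemma square_class_rep:
  assumes "q \<noteq> 0"
  obtains d where "d \<noteq> 0" "of_int (square_class_rep q) = q * of_int d * of_int d" "square_class_rep q \<noteq> 0"
proof -
  obtain n d where nd: "quotient_of q = (n, d)" by fastforce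
  then have "d > 0" "q = of_int n / of_int d"
    by (simp_all add: quotient_of_denom_pos quotient_of_div)
  with assms nd that[of d] show thesis by (auto simp: square_class_rep_def)
qed

lemma sign_character_square_class_rep:
  assumes "\<kappa> \<in> carrier sign_character_group" "q \<noteq> 0"
  shows "\<kappa> q = \<kappa> (of_int (square_class_rep q))"
proof -
  obtain d where d: "d \<noteq> 0" "of_int (square_class_rep q) = q * of_int d * of_int d"
    using square_class_rep[OF assms(2)] by metis
  then have "\<kappa> (of_int (square_class_rep q)) = \<kappa> q * (\<kappa> (of_int d) * \<kappa> (of_int d))"
    using assms by (simp add: sign_character_iff)
  also have "\<kappa> (of_int d) * \<kappa> (of_int d) = 1"
    using assms d by (metis abs_mult_self_eq mult_1 of_int_eq_0_iff sign_character_iff)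
  finally show ?thesis by simp
qed

text \<open>
  The value at \<open>q\<close> is that of \<open>\<epsilon>\<close> at an integer in the square class of \<open>q\<close>. It does not depend on
  the integer, since \<open>\<epsilon>\<close> is \<open>1\<close> at squares, and multiplicativity follows because representatives
  may be multiplied.
\<close>

lemma extend_sign_character:
  fixes \<epsilon> :: "int \<Rightarrow> int"
  assumes unit: "\<And>n. n \<noteq> 0 \<Longrightarrow> \<bar>\<epsilon> n\<bar> = 1"
    and mult: "\<And>m n. m \<noteq> 0 \<Longrightarrow> n \<noteq> 0 \<Longrightarrow> \<epsilon> (m * n) = \<epsilon> m * \<epsilon> n"
  obtains \<kappa> where "\<kappa> \<in> carrier sign_character_group" "\<And>n. n \<noteq> 0 \<Longrightarrow> \<kappa> (of_int n) = \<epsilon> n"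
proof -
  have square: "\<epsilon> n * \<epsilon> n = 1" if "n \<noteq> 0" for n
    using unit[OF that] by (metis abs_mult_self_eq mult_1)
  define \<kappa> where "\<kappa> = (\<lambda>q :: rat. if q = 0 then undefined else \<epsilon> (square_class_rep q))"
  \<comment> \<open>Integers \<open>m\<close> in the class of \<open>q\<close>; the class relation is cleared of denominators.\<close>
  have rep: "\<kappa> q = \<epsilon> m"
    if eq: "of_int m * of_int c * of_int c = q * of_int d * of_int d" and nz: "m \<noteq> 0" "c \<noteq> 0" "d \<noteq> 0" for q m c d
  proof -
    have "q \<noteq> 0" using eq nz by auto
    then obtain d' where d': "d' \<noteq> 0" "of_int (square_class_rep q) = q * of_int d' * of_int d'"
      "square_class_rep q \<noteq> 0"
      by (rule square_class_rep)
    then have "of_int (square_class_rep q * (d * d)) = (of_int (m * ((c * d') * (c * d'))) :: rat)"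
      using eq by (simp add: algebra_simps)
    then have "\<epsilon> (square_class_rep q * (d * d)) = \<epsilon> (m * ((c * d') * (c * d')))"
      by (simp only: of_int_eq_iff)
    moreover have "\<epsilon> (d * d) = 1" "\<epsilon> ((c * d') * (c * d')) = 1"
      using mult[of d d] mult[of "c * d'" "c * d'"] square[of d] square[of "c * d'"] nz d' by simp_all
    ultimately have "\<epsilon> (square_class_rep q) = \<epsilon> m"
      using mult[of "square_class_rep q" "d * d"] mult[of m "(c * d') * (c * d')"] nz d' by simp
    then show ?thesis using \<open>q \<noteq> 0\<close> by (simp add: \<kappa>_def)
  qed
  have "\<kappa> (p * q) = \<kappa> p * \<kappa> q" if nz: "p \<noteq> 0" "q \<noteq> 0" for p q
  proof -
    obtain c d where "c \<noteq> 0" "of_int (square_class_rep p) = p * of_int c * of_int c" "square_class_rep p \<noteq> 0"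
      and "d \<noteq> 0" "of_int (square_class_rep q) = q * of_int d * of_int d" "square_class_rep q \<noteq> 0"
      using nz square_class_rep by metis
    then show ?thesis
      using rep[of "square_class_rep p * square_class_rep q" 1 "p * q" "c * d"] nz
      by (simp add: \<kappa>_def mult)
  qed
  then have "\<kappa> \<in> carrier sign_character_group"
    unfolding sign_character_iff using unit square_class_rep by (auto simp: \<kappa>_def) metis
  moreover have "\<kappa> (of_int n) = \<epsilon> n" if "n \<noteq> 0" for n
    using rep[of n 1 "of_int n" 1] that by simp
  ultimately show thesis by (rule that)
qed

definition sign_twist :: "(rat \<Rightarrow> int) \<Rightarrow> int^2^2 \<Rightarrow> int^2^2" where
  "sign_twist \<kappa> A = mat (\<kappa> (of_int (det A))) ** A"

lemma sign_twist_mat2: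
  "sign_twist \<kappa> (mat2 a b c d) = (let s = \<kappa> (of_int (a * d - b * c)) in mat2 (s * a) (s * b) (s * c) (s * d))"
  by (simp add: sign_twist_def mat_eq_mat2 Let_def)

text \<open>
  The dimension \<open>2\<close> is even, so changing the sign of a matrix preserves its determinant.
\<close>

lemma det_sign_twist:
  assumes "\<kappa> \<in> carrier sign_character_group" "det A \<noteq> 0"
  shows "det (sign_twist \<kappa> A) = det A"
proof -
  have "\<kappa> (of_int (det A)) * \<kappa> (of_int (det A)) = 1"
    using assms by (metis abs_mult_self_eq mult_1 of_int_eq_0_iff sign_character_iff)
  then show ?thesis by (simp add: sign_twist_def det_mul mat_eq_mat2)
qed

lemma sign_twist_hom:
  assumes "\<kappa> \<in> carrier sign_character_group"
  shows "sign_twist \<kappa> \<in> hom M2ns M2ns"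
proof -
  have "sign_twist \<kappa> (A ** B) = sign_twist \<kappa> A ** sign_twist \<kappa> B"
    if "det A \<noteq> 0" "det B \<noteq> 0" for A B
    using that assms by (simp add: sign_character_iff sign_twist_def det_mul mat_mult_mult)
  then show ?thesis using assms by (auto simp: hom_def M2ns_def det_sign_twist)
qed

lemma sign_twist_one: "\<kappa> \<in> carrier sign_character_group \<Longrightarrow> sign_twist \<kappa> (mat 1) = mat 1"
  by (simp add: sign_twist_def sign_character_one)

lemma sign_twist_sign_twist:
  assumes "\<psi> \<in> carrier sign_character_group" "det A \<noteq> 0"
  shows "sign_twist \<kappa> (sign_twist \<psi> A) = sign_twist (\<kappa> \<otimes>\<^bsub>sign_character_group\<^esub> \<psi>) A"
proof -
  have "det (mat (\<psi> (of_int (det A))) ** A) = det A"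
    using det_sign_twist[OF assms] by (simp add: sign_twist_def)
  then show ?thesis
    using assms mat_mult_mult[of _ _ "mat 1" A] by (simp add: sign_twist_def)
qed

text \<open>
  The companion matrix with trace \<open>1\<close> and determinant \<open>n\<close> is compared on both sides: its twists have
  traces \<open>\<kappa> n\<close> and \<open>\<psi> n\<close>, and intertwined matrices have equal traces.
\<close>

lemma sign_twist_intertwined:
  assumes \<kappa>: "\<kappa> \<in> carrier sign_character_group" and \<psi>: "\<psi> \<in> carrier sign_character_group"
    and "det C \<noteq> 0"
    and intertwined: "\<And>A. det A \<noteq> 0 \<Longrightarrow> C ** sign_twist \<kappa> A = sign_twist \<psi> A ** C"
  shows "\<kappa> = \<psi>"
proof -
  have "\<kappa> (of_int n) = \<psi> (of_int n)" if "n \<noteq> 0" for n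
  proof -
    obtain a b c d where C: "C = mat2 a b c d" by (rule mat2_cases)
    let ?s = "\<kappa> (of_int n)" and ?t = "\<psi> (of_int n)"
    have "mat2 a b c d ** mat2 ?s ?s (- ?s * n) 0 = mat2 ?t ?t (- ?t * n) 0 ** mat2 a b c d"
      using intertwined[of "mat2 1 1 (- n) 0"] that by (simp add: C sign_twist_mat2 Let_def)
    then show "?s = ?t"
      using intertwined_det_trace(2) \<open>det C \<noteq> 0\<close> by (force simp: C simp del: mat2_mult)
  qed
  then have "\<kappa> q = \<psi> q" if "q \<noteq> 0" for q
    using that \<kappa> \<psi> sign_character_square_class_rep square_class_rep by metis
  then show ?thesis using \<kappa> \<psi> by (metis ext sign_character_iff)
qed

section \<open>Topos automorphisms as sign characters\<close>

lemma M2ns_simps [simp]: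
  "A \<in> carrier M2ns \<longleftrightarrow> det A \<noteq> 0" "A \<otimes>\<^bsub>M2ns\<^esub> B = A ** B" "\<one>\<^bsub>M2ns\<^esub> = mat 1"
  by (simp_all add: M2ns_def)

text \<open>
  A nonsingular idempotent has determinant \<open>1\<close>, and an invertible idempotent is the unit.
\<close>

lemma M2ns_trivial_idempotents:
  fixes E :: "int^2^2"
  assumes "det E \<noteq> 0" "E ** E = E"
  shows "E = mat 1"
proof -
  have "det E * det E = det E" using assms(2) by (metis det_mul)
  then have "\<bar>det E\<bar> = 1" using assms(1) by simp
  then obtain B where "E ** B = mat 1" by (rule right_inverse_if_abs_det_eq_one)
  then show ?thesis using assms(2) matrix_mul_assoc[of E E B] by simp
qed

text \<open>
  The matrices are countable, so they inject into every infinite set.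
\<close>

lemma regular_action_M2ns:
  fixes U :: "'u set set"
  assumes U: "set_universe U"
  obtains code where "regular_action M2ns U code"
proof -
  obtain S where S: "S \<in> U" "infinite S"
    using U by (auto simp: set_universe_def)
  then obtain f :: "nat \<Rightarrow> 'u" where f: "inj f" "range f \<subseteq> S"
    using infinite_countable_subset by blast
  have down: "T \<in> U" if "S \<in> U" "T \<subseteq> S" for S T
    using U that unfolding set_universe_def by blast
  have "regular_action M2ns U (\<lambda>A. f (to_nat A))"
  proof (intro regular_action.intro regular_action_axioms.intro monoid_M2ns)
    show "T \<in> U" if "S \<in> U" "T \<subseteq> S" for S T by (rule down[OF that])
    show "(\<lambda>A. f (to_nat A)) ` carrier M2ns \<in> U"
      by (rule down[OF S(1)]) (use f in auto)
    show "inj_on (\<lambda>A. f (to_nat A)) (carrier M2ns)"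
      by (rule inj_onI) (simp add: inj_eq[OF f(1)])
  qed
  then show thesis by (rule that)
qed

lemma sign_twist_endomorphism:
  assumes "\<kappa> \<in> carrier sign_character_group"
  shows "monoid_endomorphism M2ns (sign_twist \<kappa>)"
  using monoid_M2ns sign_twist_hom[OF assms] sign_twist_one[OF assms]
  by (simp add: monoid_endomorphism_def monoid_endomorphism_axioms_def)

lemma sign_twist_involution:
  assumes \<kappa>: "\<kappa> \<in> carrier sign_character_group" and A: "det A \<noteq> 0"
  shows "sign_twist \<kappa> (sign_twist \<kappa> A) = A"
proof -
  have "\<kappa> (of_int (det A)) * \<kappa> (of_int (det A)) = 1"
    using assms by (metis abs_mult_self_eq mult_1 of_int_eq_0_iff sign_character_iff)
  then show ?thesis
    using A unfolding sign_twist_sign_twist[OF \<kappa> A] by (simp add: sign_twist_def)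
qed

text \<open>
  By the two classification results \<open>F\<close> is the twist by an automorphism \<open>\<alpha>\<close> with
  \<open>P \<alpha> A = (\<epsilon> (det A) A) P\<close> for a unimodular \<open>P\<close>. Composing the bijection from \<open>X\<close> to \<open>F X\<close> with the
  action of \<open>P\<close> on \<open>F X\<close> replaces \<open>\<alpha>\<close> by the sign twist. The twist functor precomposes the action while
  \<open>\<theta>\<close> twists the target; the two agree because a sign twist is its own inverse.
\<close>

lemma auto_equivalence_is_sign_twist:
  fixes U :: "'u set set"
  assumes U: "set_universe U" and F: "F \<in> auto_equivalences (action_category M2ns U)"
  shows "\<exists>\<kappa>\<in>carrier sign_character_group.
    naturally_isomorphic (action_category M2ns U) (action_category M2ns U) F (twist_functor M2ns (sign_twist \<kappa>))"
proof -
  obtain code where code: "regular_action M2ns U code"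
    using U by (rule regular_action_M2ns)
  interpret F: action_auto_equivalence M2ns U code F
    using code F M2ns_trivial_idempotents
    by (simp add: action_auto_equivalence_def action_auto_equivalence_axioms_def)
  obtain \<alpha> \<theta> where \<alpha>: "\<alpha> \<in> iso M2ns M2ns"
    and bij: "\<And>X. X \<in> F.OB \<Longrightarrow> bij_betw (\<theta> X) (carrier X) (carrier (obj_map F X))"
    and twisted: "\<And>X A x. X \<in> F.OB \<Longrightarrow> A \<in> carrier M2ns \<Longrightarrow> x \<in> carrier X \<Longrightarrow>
      \<theta> X (act X A x) = act (obj_map F X) (\<alpha> A) (\<theta> X x)"
    and natural: "\<And>X Y f x. X \<in> F.OB \<Longrightarrow> Y \<in> F.OB \<Longrightarrow> f \<in> equivariant_maps M2ns X Y \<Longrightarrow> x \<in> carrier X \<Longrightarrow>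
      \<theta> Y (f x) = fun_map F X Y f (\<theta> X x)"
    using F.auto_equivalence_is_twist by blast
  obtain P Q \<epsilon> where PQ: "P ** Q = mat 1" "Q ** P = mat 1"
    and \<epsilon>: "\<And>n. n \<noteq> 0 \<Longrightarrow> \<bar>\<epsilon> n :: int\<bar> = 1"
      "\<And>m n. m \<noteq> 0 \<Longrightarrow> n \<noteq> 0 \<Longrightarrow> \<epsilon> (m * n) = \<epsilon> m * \<epsilon> n"
    and P\<alpha>: "\<And>A. det A \<noteq> 0 \<Longrightarrow> P ** \<alpha> A = mat (\<epsilon> (det A)) ** A ** P"
    using M2ns_automorphism_sign_conjugation[OF \<alpha>] by blast
  have P: "det P \<noteq> 0" and Q: "det Q \<noteq> 0"
    using det_mul[of P Q] PQ(1) by auto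
  obtain \<kappa> where \<kappa>: "\<kappa> \<in> carrier sign_character_group" and \<kappa>\<epsilon>: "\<And>n. n \<noteq> 0 \<Longrightarrow> \<kappa> (of_int n) = \<epsilon> n"
    using extend_sign_character[of \<epsilon>, OF \<epsilon>] by blast
  have P_sign: "P ** \<alpha> A = sign_twist \<kappa> A ** P" if "det A \<noteq> 0" for A
    using P\<alpha>[OF that] \<kappa>\<epsilon>[OF that] by (simp add: sign_twist_def)
  interpret T: monoid_endomorphism M2ns "sign_twist \<kappa>"
    by (rule sign_twist_endomorphism[OF \<kappa>])
  let ?T = "twist_functor M2ns (sign_twist \<kappa>) :: (_, _, _, (int^2^2, 'u) action_arrow) functor_data"
  have FX: "is_action_set M2ns (obj_map F X)" and isX: "is_action_set M2ns X" if "X \<in> F.OB" for X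
    using F.OB_is_action_set F.obj_map_OB that by blast+
  define \<eta> where "\<eta> X = (\<lambda>x\<in>carrier X. act (obj_map F X) P (\<theta> X x))" for X
  have \<theta>_closed: "\<theta> X x \<in> carrier (obj_map F X)" if "X \<in> F.OB" "x \<in> carrier X" for X x
    using bij[OF that(1)] that(2) by (rule bij_betw_apply)
  have \<eta>_closed: "\<eta> X x \<in> carrier (obj_map F X)" if "X \<in> F.OB" "x \<in> carrier X" for X x
    using that P act_closed[OF FX[OF that(1)] _ \<theta>_closed[OF that]] by (simp add: \<eta>_def)
  have \<eta>_twisted: "\<eta> X (act X (sign_twist \<kappa> A) x) = act (obj_map F X) A (\<eta> X x)"
    if X: "X \<in> F.OB" and A: "det A \<noteq> 0" and x: "x \<in> carrier X" for X A x
  proof -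
    let ?B = "sign_twist \<kappa> A"
    have B: "det ?B \<noteq> 0" using T.closed[of A] A by simp
    have \<alpha>B: "det (\<alpha> ?B) \<noteq> 0" using \<alpha> B by (auto simp: iso_def hom_def)
    have "\<eta> X (act X ?B x) = act (obj_map F X) P (act (obj_map F X) (\<alpha> ?B) (\<theta> X x))"
      using twisted[OF X _ x, of ?B] B act_closed[OF isX[OF X] _ x] by (simp add: \<eta>_def)
    also have "\<dots> = act (obj_map F X) (P ** \<alpha> ?B) (\<theta> X x)"
      using action_set_mult[OF FX[OF X], of P "\<alpha> ?B"] P \<alpha>B \<theta>_closed[OF X x] by simp
    also have "P ** \<alpha> ?B = A ** P"
      unfolding P_sign[OF B] sign_twist_involution[OF \<kappa> A] ..
    also have "act (obj_map F X) (A ** P) (\<theta> X x) = act (obj_map F X) A (\<eta> X x)"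
      using action_set_mult[OF FX[OF X], of A P] A P \<theta>_closed[OF X x] x by (simp add: \<eta>_def)
    finally show ?thesis .
  qed
  have "naturally_isomorphic (action_category M2ns U) (action_category M2ns U) ?T F"
  proof (rule action_functors_naturally_isomorphicI)
    show "action_functor M2ns U ?T"
      by (rule action_functor.intro[OF T.twist_functor_is_functor])
    show "action_functor M2ns U F" by (rule F.action_functor_axioms)
  next
    fix X assume X: "X \<in> F.OB"
    show "\<eta> X \<in> equivariant_maps M2ns (obj_map ?T X) (obj_map F X)"
      using \<eta>_closed[OF X] \<eta>_twisted[OF X] by (simp add: equivariant_maps_def PiE_def Pi_iff) (simp add: \<eta>_def)
    have "bij_betw (act (obj_map F X) P) (carrier (obj_map F X)) (carrier (obj_map F X))"
      using action_set_mult[OF FX[OF X], of P Q] action_set_mult[OF FX[OF X], of Q P]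
        action_set_one[OF FX[OF X]] act_closed[OF FX[OF X]] P Q PQ
      by (intro bij_betw_byWitness[where f' = "act (obj_map F X) Q"]) auto
    then have "bij_betw (act (obj_map F X) P \<circ> \<theta> X) (carrier X) (carrier (obj_map F X))"
      by (rule bij_betw_trans[OF bij[OF X]])
    then show "bij_betw (\<eta> X) (carrier (obj_map ?T X)) (carrier (obj_map F X))"
      using bij_betw_cong[of "carrier X" "\<eta> X" "act (obj_map F X) P \<circ> \<theta> X"] by (simp add: \<eta>_def)
  next
    fix X Y f x
    assume X: "X \<in> F.OB" and Y: "Y \<in> F.OB" and f: "f \<in> equivariant_maps M2ns X Y"
      and "x \<in> carrier (obj_map ?T X)"
    then have x: "x \<in> carrier X" by simp
    have "\<eta> Y (f x) = act (obj_map F Y) P (fun_map F X Y f (\<theta> X x))"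
      using natural[OF X Y f x] equivariant_closed[OF f x] by (simp add: \<eta>_def)
    also have "\<dots> = fun_map F X Y f (act (obj_map F X) P (\<theta> X x))"
      using equivariant_act[OF F.fun_map_equivariant[OF X Y f] _ \<theta>_closed[OF X x]] P by simp
    finally show "\<eta> Y (fun_map ?T X Y f x) = fun_map F X Y f (\<eta> X x)"
      using x by (simp add: \<eta>_def)
  qed
  then have "naturally_isomorphic (action_category M2ns U) (action_category M2ns U) F ?T"
    by (rule F.C.naturally_isomorphic_sym[OF T.twist_functor_is_functor F.functorial])
  with \<kappa> show ?thesis by blast
qed

theorem theorem12:
  fixes U :: "'u set set"
  assumes "set_universe U"
  shows "group (auto_equivalence_group (action_category M2ns U)) \<and>
         group sign_character_group \<and>
         auto_equivalence_group (action_category M2ns U) \<cong> sign_character_group"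
proof -
  interpret C: is_category "action_category M2ns U" by (rule action_category_is_category)
  interpret K: group sign_character_group by (rule group_sign_character_group)
  obtain code where "regular_action M2ns U code"
    using assms by (rule regular_action_M2ns)
  then interpret regular_action M2ns U code .
  have "group (auto_equivalence_group (action_category M2ns U)) \<and>
      auto_equivalence_group (action_category M2ns U) \<cong> sign_character_group"
  proof (rule C.auto_equivalence_group_iso_if_representatives
      [where T = "\<lambda>\<kappa>. twist_functor M2ns (sign_twist \<kappa>)", OF group_sign_character_group])
    fix \<kappa> assume \<kappa>: "\<kappa> \<in> carrier sign_character_group"
    note twist = sign_twist_endomorphism[OF \<kappa>] and involution = sign_twist_involution[OF \<kappa>]
    show "twist_functor M2ns (sign_twist \<kappa>) \<in> auto_equivalences (action_category M2ns U)"
      by (rule twist_functor_auto_equivalence[OF twist twist]) (simp_all add: involution)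
    fix \<psi> assume \<psi>: "\<psi> \<in> carrier sign_character_group"
    show "naturally_isomorphic (action_category M2ns U) (action_category M2ns U)
        (comp_functor (twist_functor M2ns (sign_twist \<kappa>)) (twist_functor M2ns (sign_twist \<psi>)))
        (twist_functor M2ns (sign_twist (\<kappa> \<otimes>\<^bsub>sign_character_group\<^esub> \<psi>)))"
    proof (rule comp_twist_functor[OF twist sign_twist_endomorphism[OF \<psi>]
          sign_twist_endomorphism[OF K.m_closed[OF \<kappa> \<psi>]]])
      fix A assume A: "A \<in> carrier M2ns"
      then show "sign_twist \<psi> (sign_twist \<kappa> A) = sign_twist (\<kappa> \<otimes>\<^bsub>sign_character_group\<^esub> \<psi>) A"
        using sign_twist_sign_twist[OF \<kappa>, of A \<psi>] by (simp add: sign_twist_def mult.commute)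
    qed
    assume "naturally_isomorphic (action_category M2ns U) (action_category M2ns U)
        (twist_functor M2ns (sign_twist \<kappa>)) (twist_functor M2ns (sign_twist \<psi>))"
    then obtain C where C: "C \<in> carrier M2ns"
      and intertwined: "\<And>A. A \<in> carrier M2ns \<Longrightarrow> C \<otimes>\<^bsub>M2ns\<^esub> sign_twist \<kappa> A = sign_twist \<psi> A \<otimes>\<^bsub>M2ns\<^esub> C"
      using naturally_isomorphic_twists[OF twist sign_twist_endomorphism[OF \<psi>]] by blast
    show "\<kappa> = \<psi>"
      using C intertwined by (intro sign_twist_intertwined[OF \<kappa> \<psi>, of C]) simp_all
  next
    show "naturally_isomorphic (action_category M2ns U) (action_category M2ns U)
        (twist_functor M2ns (sign_twist \<one>\<^bsub>sign_character_group\<^esub>)) id_functor"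
      by (rule twist_functor_identity[OF sign_twist_endomorphism[OF K.one_closed]]) (simp add: sign_twist_def)
  next
    fix F assume "F \<in> auto_equivalences (action_category M2ns U)"
    then show "\<exists>\<kappa>\<in>carrier sign_character_group. naturally_isomorphic (action_category M2ns U)
        (action_category M2ns U) F (twist_functor M2ns (sign_twist \<kappa>))"
      by (rule auto_equivalence_is_sign_twist[OF assms])
  qed
  with group_sign_character_group show ?thesis by blast
qed

end
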